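(* For $n\ge 1$ let $\tau_n$ denote the kissing number in $\mathbb{R}^n$, i.e. the maximal number $N$ of points $x_1,\dots,x_N$ on the unit sphere $S^{n-1}\subset\mathbb{R}^n$ with $\langle x_i,x_j\rangle\le 1/2$ for all $i\neq j$. Then $\tau_{25}\ge 197048$, $\tau_{26}\ge 198512$, $\tau_{27}\ge 199976$, $\tau_{28}\ge 204368$, $\tau_{29}\ge 208272$, $\tau_{30}\ge 219984$, and $\tau_{31}\ge 232874$.
   Context: The kissing number in $\mathbb{R}^n$ is equivalently the maximal number of non-overlapping unit balls that are externally tangent to a fixed unit ball. *)

theory Defs
  imports "HOL-Analysis.Analysis"
begin

definition rn_space :: "nat \<Rightarrow> (nat \<Rightarrow> real) set" where
  "rn_space n = {x. \<forall>i\<ge>n. x i = 0}"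

definition rn_inner :: "nat \<Rightarrow> (nat \<Rightarrow> real) \<Rightarrow> (nat \<Rightarrow> real) \<Rightarrow> real" where
  "rn_inner n x y = (\<Sum>i<n. x i * y i)"

definition unit_sphere :: "nat \<Rightarrow> (nat \<Rightarrow> real) set" where
  "unit_sphere n = {x \<in> rn_space n. rn_inner n x x = 1}"

definition kissing_config :: "nat \<Rightarrow> (nat \<Rightarrow> real) set \<Rightarrow> bool" where
  "kissing_config n X \<longleftrightarrow> finite X \<and> X \<subseteq> unit_sphere n \<and>
     (\<forall>x\<in>X. \<forall>y\<in>X. x \<noteq> y \<longrightarrow> rn_inner n x y \<le> 1/2)"

definition kissing_number :: "nat \<Rightarrow> nat" where
  "kissing_number n = Sup {card X | X. kissing_config n X}"

end

theory Submission
  imports Defs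
begin

text \<open>
  Start from the \<open>196560\<close> minimal vectors of the Leech lattice. Let \<open>U\<close> be a set of minimal vectors,
  coloured so that different vectors of the same colour have cosine at most \<open>1/4\<close>, and give every
  colour its own triangle of unit vectors of \<open>\<real>\<^sup>k\<close> with angles of 120 degrees, all these triangles
  together forming a kissing configuration of \<open>\<real>\<^sup>k\<close>. If each \<open>x \<in> U\<close> is replaced by the three points
  \<open>(sqrt (2/3) x, sqrt (1/3) p)\<close>, \<open>p\<close> in the triangle of the colour of \<open>x\<close>, the result is a kissing
  configuration of \<open>\<real>\<^sup>2\<^sup>4\<^sup>+\<^sup>k\<close> with \<open>2 |U|\<close> additional points. For \<open>k = 1\<close> the pair \<open>1, -1\<close> takes the
  role of the triangle.

  The colour classes are images of one code of 498 minimal vectors under sign changes on Golay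
  codewords, which are automorphisms of the Leech lattice. The triangles are taken from the root
  systems \<open>A\<^sub>2\<close>, \<open>A\<^sub>3\<close>, \<open>D\<^sub>4\<close>, \<open>D\<^sub>5\<close>, \<open>E\<^sub>6\<close>, \<open>E\<^sub>7\<close>.
\<close>

section \<open>Kissing configurations over a coloured one\<close>

text \<open>Sign changes on Golay codewords preserve both the minimal vectors and all inner
  products. Hence one pairwise check of the code serves every colour, and no inner product between
  different colours has to be examined: the Leech bound 1/2 is enough there. Only the size of the
  union \<open>U\<close> matters, so the copies may overlap; a vector lying in several copies takes
  one of their colours. The number \<open>m\<close> of colours is the number of disjoint triangles
  available in the root system: 2, 4, 8, 12, 24, 39 for \<open>k\<close> = 2, ..., 7. In dimensions
  25, 26, 28, 29 and 30 the claimed numbers are 196560 plus the gain of \<open>m\<close> disjoint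
  classes of 488 vectors each. The code here has 498, and this surplus pays for the overlaps. The
  large finite facts (Golay weights, pairwise distances in the code, sizes of unions) are
  established by rewriting explicit lists. This shapes the encodings: codewords as lists of
  booleans, small numbers in unary, and tries for counting distinct vectors.\<close>

lemma rn_inner_commute: "rn_inner n x y = rn_inner n y x"
  by (simp add: rn_inner_def mult.commute)

lemma rn_inner_diff:
  "(\<Sum>i<n. (x i - y i)^2) = rn_inner n x x + rn_inner n y y - 2 * rn_inner n x y"
  by (simp add: rn_inner_def power2_diff sum.distrib sum_subtractf sum_distrib_left
      power2_eq_square algebra_simps)

text \<open>A supremum of naturals is informative only for a bounded set, so some bound is needed,
  however crude. On a grid of mesh \<open>1/n\<close>, two points of one cell have squared distance
  below \<open>n * (1/n)^2\<close>, hence below 1, which for unit vectors means inner product above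
  1/2. So each cell holds at most one point.\<close>

lemma kissing_config_card_le:
  assumes "kissing_config n X"
  shows "card X \<le> card (PiE {..<n} (\<lambda>_. {- int n..int n}))"
proof (rule card_inj_on_le)
  let ?f = "\<lambda>x. restrict (\<lambda>i. \<lfloor>real n * x i\<rfloor>) {..<n}"
  have sphere: "rn_inner n x x = 1" "\<forall>i\<ge>n. x i = 0" if "x \<in> X" for x
    using assms that by (auto simp: kissing_config_def unit_sphere_def rn_space_def)
  show "inj_on ?f X"
  proof (rule inj_onI, rule ccontr)
    fix x y assume xy: "x \<in> X" "y \<in> X" "?f x = ?f y" "x \<noteq> y"
    have n: "n > 0"
      using sphere(1)[OF xy(1)] by (cases n) (auto simp: rn_inner_def)
    have close: "(x i - y i)^2 < (1 / real n)^2" if "i < n" for i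
    proof -
      have "\<lfloor>real n * x i\<rfloor> = \<lfloor>real n * y i\<rfloor>"
        using fun_cong[OF xy(3), of i] that by simp
      then have "\<bar>real n * x i - real n * y i\<bar> < 1" by linarith
      then have "real n * \<bar>x i - y i\<bar> < 1"
        by (metis abs_mult abs_of_nat right_diff_distrib)
      then have "\<bar>x i - y i\<bar> < 1 / real n"
        using n by (simp add: field_simps)
      then show ?thesis
        by (metis abs_ge_zero power2_abs power_strict_mono zero_less_numeral)
    qed
    have "(\<Sum>i<n. (x i - y i)^2) < (\<Sum>i<n. (1 / real n)^2)"
      using n close by (intro sum_strict_mono) auto
    also have "\<dots> \<le> 1"
      using n by (simp add: power2_eq_square field_simps)
    finally have "rn_inner n x y > 1/2"
      using sphere(1)[OF xy(1)] sphere(1)[OF xy(2)] by (simp add: rn_inner_diff)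
    moreover have "rn_inner n x y \<le> 1/2"
      using assms xy by (auto simp: kissing_config_def)
    ultimately show False by simp
  qed
  show "?f ` X \<subseteq> PiE {..<n} (\<lambda>_. {- int n..int n})"
  proof (intro image_subsetI PiE_I)
    fix x i assume x: "x \<in> X" and i: "i \<in> {..<n}"
    have "(x i)^2 \<le> (\<Sum>i<n. (x i)^2)"
      using i by (intro member_le_sum) auto
    also have "\<dots> = 1"
      using sphere(1)[OF x] by (simp add: rn_inner_def power2_eq_square)
    finally have "\<bar>x i\<bar> \<le> 1"
      by (simp add: abs_square_le_1)
    then have "x i \<le> 1" "- 1 \<le> x i" by auto
    then have "real n * x i \<le> real n" "- real n \<le> real n * x i"
      using mult_left_mono[of "x i" 1 "real n"] mult_left_mono[of "-1" "x i" "real n"] by auto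
    then have "\<lfloor>real n * x i\<rfloor> \<le> int n" "- int n \<le> \<lfloor>real n * x i\<rfloor>" by linarith+
    then show "?f x i \<in> {- int n..int n}"
      using i by simp
  qed auto
  show "finite (PiE {..<n} (\<lambda>_. {- int n..int n}))"
    by (intro finite_PiE) auto
qed

lemma kissing_number_ge:
  assumes "kissing_config n X"
  shows "card X \<le> kissing_number n"
  unfolding kissing_number_def
proof (rule cSup_upper)
  show "bdd_above {card X |X. kissing_config n X}"
    using kissing_config_card_le by (intro bdd_aboveI) auto
qed (use assms in auto)

definition glue :: "nat \<Rightarrow> (nat \<Rightarrow> real) \<Rightarrow> (nat \<Rightarrow> real) \<Rightarrow> nat \<Rightarrow> real" where
  "glue d x p i = (if i < d then x i else p (i - d))"

lemma sum_split_add: "(\<Sum>i<d + k. f i) = (\<Sum>i<d. f i) + (\<Sum>i<k. f (d + i))" for f :: "nat \<Rightarrow> real"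
  by (induction k) (auto simp: add.assoc)

lemma rn_inner_glue:
  "rn_inner (d + k) (glue d x p) (glue d y q) = rn_inner d x y + rn_inner k p q"
  by (simp add: rn_inner_def sum_split_add glue_def)

lemma rn_inner_scale: "rn_inner d (\<lambda>i. a * x i) (\<lambda>i. b * y i) = a * b * rn_inner d x y"
  by (simp add: rn_inner_def sum_distrib_left algebra_simps)

lemma rn_inner_zero [simp]: "rn_inner d (\<lambda>i. 0) x = 0" "rn_inner d x (\<lambda>i. 0) = 0"
  by (simp_all add: rn_inner_def)

lemma glue_in_space: "p \<in> rn_space k \<Longrightarrow> glue d x p \<in> rn_space (d + k)"
  by (auto simp: rn_space_def glue_def)

lemma glue_eqD:
  assumes "glue d x p = glue d y q" "x \<in> rn_space d" "y \<in> rn_space d"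
  shows "x = y" "p = q"
proof -
  show "x = y"
  proof
    fix i show "x i = y i"
      using fun_cong[OF assms(1), of i] assms(2,3) by (cases "i < d") (auto simp: glue_def rn_space_def)
  qed
  show "p = q"
  proof
    fix i show "p i = q i"
      using fun_cong[OF assms(1), of "d + i"] by (simp add: glue_def)
  qed
qed

text \<open>
  The weights \<open>2/3\<close> and \<open>1/3\<close> are forced: points of one triangle over the same centre need
  \<open>a - b/2 \<le> 1/2\<close>, different centres with the same triangle need \<open>a/4 + b \<le> 1/2\<close>, where \<open>a + b = 1\<close>.
\<close>

lemma kissing_number_lift:
  assumes M: "kissing_config d M" and U: "U \<subseteq> M"
    and col: "\<And>x. x \<in> U \<Longrightarrow> col x < m"
    and same: "\<And>x y. \<lbrakk>x \<in> U; y \<in> U; x \<noteq> y; col x = col y\<rbrakk> \<Longrightarrow> rn_inner d x y \<le> 1/4"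
    and T: "\<And>j. j < m \<Longrightarrow> finite (T j) \<and> card (T j) = Suc t \<and> T j \<subseteq> unit_sphere k"
    and inside: "\<And>j p q. \<lbrakk>j < m; p \<in> T j; q \<in> T j; p \<noteq> q\<rbrakk> \<Longrightarrow> rn_inner k p q \<le> - 1/2"
    and across: "\<And>i j p q. \<lbrakk>i < m; j < m; i \<noteq> j; p \<in> T i; q \<in> T j\<rbrakk> \<Longrightarrow> rn_inner k p q \<le> 1/2"
  shows "card M + t * card U \<le> kissing_number (d + k)"
proof -
  define a b :: real where "a = sqrt (2/3)" and "b = sqrt (1/3)"
  have ab: "a * a = 2/3" "b * b = 1/3" "0 < a" "a < 1"
    unfolding a_def b_def by (auto simp: real_less_lsqrt)
  define flat where "flat x = glue d x (\<lambda>_. 0)" for x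
  define tilt where "tilt x p = glue d (\<lambda>i. a * x i) (\<lambda>i. b * p i)" for x p
  let ?P = "SIGMA x:U. T (col x)"
  let ?X = "flat ` (M - U) \<union> case_prod tilt ` ?P"
  have finM: "finite M" and spM: "\<And>x. x \<in> M \<Longrightarrow> rn_inner d x x = 1 \<and> x \<in> rn_space d"
    and ipM: "\<And>x y. \<lbrakk>x \<in> M; y \<in> M; x \<noteq> y\<rbrakk> \<Longrightarrow> rn_inner d x y \<le> 1/2"
    using M by (auto simp: kissing_config_def unit_sphere_def)
  have finU: "finite U" using finM U finite_subset by blast
  have spT: "rn_inner k p p = 1 \<and> p \<in> rn_space k" if "p \<in> T (col x)" "x \<in> U" for x p
    using T[OF col[OF that(2)]] that by (auto simp: unit_sphere_def)
  have scaled: "(\<lambda>i. a * x i) \<in> rn_space d" if "x \<in> rn_space d" for x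
    using that by (auto simp: rn_space_def)
  have ip_flat: "rn_inner (d + k) (flat x) (flat y) = rn_inner d x y" for x y
    by (simp add: flat_def rn_inner_glue)
  have ip_flat_tilt: "rn_inner (d + k) (flat x) (tilt y p) = a * rn_inner d x y" for x y p
    using rn_inner_scale[of d 1 x a y] by (simp add: flat_def tilt_def rn_inner_glue)
  have ip_tilt: "rn_inner (d + k) (tilt x p) (tilt y q) = 2/3 * rn_inner d x y + 1/3 * rn_inner k p q"
    for x y p q
    by (simp add: tilt_def rn_inner_glue rn_inner_scale ab)
  have inj_flat: "inj_on flat (M - U)"
    using spM by (auto simp: inj_on_def flat_def dest: glue_eqD(1))
  have inj_tilt: "inj_on (case_prod tilt) ?P"
  proof (rule inj_onI, clarify)
    fix x p y q
    assume xy: "x \<in> U" "y \<in> U" "tilt x p = tilt y q"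
    then have "(\<lambda>i. a * x i) = (\<lambda>i. a * y i)" "(\<lambda>i. b * p i) = (\<lambda>i. b * q i)"
      using glue_eqD[OF xy(3)[unfolded tilt_def]] scaled spM U by blast+
    then show "x = y \<and> p = q"
      using ab by (auto simp: fun_eq_iff)
  qed
  \<comment> \<open>An untouched point sees only the shrunken first component of a tilted one; as
    \<open>a < 1\<close>, the bound 1/2 survives the shrinking.\<close>
  have apart: "rn_inner (d + k) (flat x) (tilt y p) \<le> 1/2" if "x \<in> M - U" "y \<in> U" for x y p
  proof -
    have "rn_inner d x y \<le> 1/2" using that U by (intro ipM) auto
    then have "a * rn_inner d x y \<le> a * (1/2)" using ab by (intro mult_left_mono) auto
    then show ?thesis unfolding ip_flat_tilt using ab(4) by linarith
  qed
  have ntt: "rn_inner (d + k) (tilt y p) (tilt y p) = 1" if "y \<in> U" "p \<in> T (col y)" for y p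
    using spT[OF that(2,1)] spM U that by (auto simp: ip_tilt)
  \<comment> \<open>A common point would have inner product 1 with itself, against the bound 1/2 of
    \<open>apart\<close>.\<close>
  have disj: "flat ` (M - U) \<inter> case_prod tilt ` ?P = {}"
  proof (rule ccontr)
    assume "flat ` (M - U) \<inter> case_prod tilt ` ?P \<noteq> {}"
    then obtain x y p where xyp: "x \<in> M - U" "y \<in> U" "p \<in> T (col y)" "flat x = tilt y p"
      by fastforce
    with apart[OF xyp(1,2), of p] ntt[OF xyp(2,3)] show False by simp
  qed
  \<comment> \<open>The bounds are 2/3 - 1/6 for the same centre, 2/3 * 1/4 + 1/3 for the same
    colour and 1/3 + 1/6 for different colours: exactly 1/2 each time.\<close>
  have tilts: "rn_inner (d + k) (tilt x p) (tilt y q) \<le> 1/2"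
    if "x \<in> U" "y \<in> U" "p \<in> T (col x)" "q \<in> T (col y)" "(x, p) \<noteq> (y, q)" for x y p q
  proof (cases "x = y")
    case True
    then have "rn_inner k p q \<le> - 1/2" using that col inside by blast
    then show ?thesis using True spM U that by (auto simp: ip_tilt)
  next
    case False
    show ?thesis
    proof (cases "col x = col y")
      case True
      have "rn_inner k p q \<le> 1"
      proof (cases "p = q")
        case True then show ?thesis using spT that by auto
      next
        case False
        then have "rn_inner k p q \<le> - 1/2" using inside[OF col] True that by metis
        then show ?thesis by simp
      qed
      then show ?thesis using same[OF that(1,2) False True] by (simp add: ip_tilt)
    next
      case cols: False
      have "rn_inner d x y \<le> 1/2" using ipM that False U by blast
      moreover have "rn_inner k p q \<le> 1/2" using across[OF col col cols] that by blast
      ultimately show ?thesis by (simp add: ip_tilt)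
    qed
  qed
  have finP: "finite ?P" using finU T col by (intro finite_SigmaI) auto
  have conf: "kissing_config (d + k) ?X"
    unfolding kissing_config_def
  proof (intro conjI ballI impI)
    show "finite ?X" using finM finP by auto
    show "?X \<subseteq> unit_sphere (d + k)"
    proof -
      have "flat x \<in> unit_sphere (d + k)" if "x \<in> M" for x
        using spM[OF that] glue_in_space[of "\<lambda>_. 0" k d x]
        by (auto simp: unit_sphere_def ip_flat) (auto simp: flat_def rn_space_def)
      moreover have "tilt x p \<in> unit_sphere (d + k)" if "x \<in> U" "p \<in> T (col x)" for x p
        using spT[OF that(2,1)] ntt[OF that] glue_in_space[of "\<lambda>i. b * p i" k d]
        by (auto simp: unit_sphere_def) (auto simp: tilt_def rn_space_def)
      ultimately show ?thesis by auto
    qed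
    fix u v assume "u \<in> ?X" "v \<in> ?X" "u \<noteq> v"
    then consider (ff) x y where "u = flat x" "v = flat y" "x \<in> M" "y \<in> M" "x \<noteq> y"
      | (ft) x y q where "u = flat x" "v = tilt y q" "x \<in> M - U" "y \<in> U"
      | (tf) x y p where "u = tilt x p" "v = flat y" "x \<in> U" "y \<in> M - U"
      | (tt) x p y q where "u = tilt x p" "v = tilt y q" "x \<in> U" "p \<in> T (col x)"
          "y \<in> U" "q \<in> T (col y)" "(x, p) \<noteq> (y, q)"
      by fast
    then show "rn_inner (d + k) u v \<le> 1/2"
    proof cases
      case ff then show ?thesis using ipM by (simp add: ip_flat)
    next
      case ft then show ?thesis using apart by simp
    next
      case tf then show ?thesis using apart[of y x p] by (simp add: rn_inner_commute)
    next
      case tt then show ?thesis using tilts by simp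
    qed
  qed
  have "card ?P = Suc t * card U"
    using T col finU by (subst card_SigmaI) auto
  then have "card ?X = card (M - U) + Suc t * card U"
    using disj finM finP by (simp add: card_Un_disjoint card_image inj_flat inj_tilt)
  also have "\<dots> = card M + t * card U"
    using card_Diff_subset[OF finU U] card_mono[OF finM U] by simp
  finally show ?thesis using kissing_number_ge[OF conf] by simp
qed

section \<open>The binary Golay code\<close>

definition xor_word :: "bool list \<Rightarrow> bool list \<Rightarrow> bool list" where
  "xor_word = map2 (\<noteq>)"

lemma xor_word_simps [simp]:
  "xor_word (x # xs) (y # ys) = (x \<noteq> y) # xor_word xs ys"
  "xor_word [] ys = []" "xor_word xs [] = []"
  by (simp_all add: xor_word_def)

lemma length_xor_word [simp]: "length (xor_word xs ys) = min (length xs) (length ys)"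
  by (simp add: xor_word_def)

lemma nth_xor_word [simp]:
  "\<lbrakk>i < length xs; i < length ys\<rbrakk> \<Longrightarrow> xor_word xs ys ! i = (xs ! i \<noteq> ys ! i)"
  by (simp add: xor_word_def)

fun combine :: "bool list \<Rightarrow> bool list list \<Rightarrow> bool list \<Rightarrow> bool list" where
  "combine (u # us) (b # bs) acc = combine us bs (if u then xor_word b acc else acc)"
| "combine _ _ acc = acc"

lemma length_combine:
  "\<lbrakk>\<forall>b\<in>set bs. length b = n; length acc = n\<rbrakk> \<Longrightarrow> length (combine u bs acc) = n"
  by (induction u bs acc rule: combine.induct) auto

lemma combine_xor:
  assumes "length u = length bs" "length v = length bs" "\<forall>b\<in>set bs. length b = n"
    "length a = n" "length c = n"
  shows "combine (xor_word u v) bs (xor_word a c) = xor_word (combine u bs a) (combine v bs c)"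
  using assms
proof (induction bs arbitrary: u v a c)
  case (Cons b bs)
  obtain x us y vs where uv: "u = x # us" "v = y # vs"
    using Cons.prems by (metis length_Suc_conv)
  let ?add = "\<lambda>x w. if x then xor_word b w else w"
  have "?add (x \<noteq> y) (xor_word a c) = xor_word (?add x a) (?add y c)"
    using Cons.prems by (auto intro!: nth_equalityI)
  then show ?case
    using Cons uv by simp
qed auto

text \<open>A binary tree over the choices of basis words. The accumulator lets all combinations
  with the same initial choices share their partial sum.\<close>

fun count_words :: "(bool list \<Rightarrow> bool) \<Rightarrow> bool list list \<Rightarrow> bool list \<Rightarrow> nat" where
  "count_words P [] acc = (if P acc then 1 else 0)"
| "count_words P (b # bs) acc = count_words P bs acc + count_words P bs (xor_word b acc)"

lemma finite_words: "finite {u :: bool list. length u = n \<and> Q u}"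
  using finite_lists_length_eq[of "UNIV :: bool set" n] by (rule finite_subset[rotated]) auto

lemma count_words:
  "count_words P bs acc = card {u. length u = length bs \<and> P (combine u bs acc)}"
proof (induction bs arbitrary: acc)
  case Nil
  have "{u. length u = length [] \<and> P (combine u [] acc)} = (if P acc then {[]} else {})"
    by auto
  then show ?case by simp
next
  case (Cons b bs)
  let ?A = "\<lambda>x. {u. length u = length bs \<and> P (combine u bs (if x then xor_word b acc else acc))}"
  have "{u. length u = length (b # bs) \<and> P (combine u (b # bs) acc)}
      = (#) False ` ?A False \<union> (#) True ` ?A True" (is "_ = ?F \<union> ?T")
  proof (intro set_eqI iffI)
    fix u assume "u \<in> {u. length u = length (b # bs) \<and> P (combine u (b # bs) acc)}"
    then show "u \<in> ?F \<union> ?T" by (cases u; cases "hd u") auto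
  qed auto
  moreover have "card (?F \<union> ?T) = card ?F + card ?T"
    by (intro card_Un_disjoint finite_imageI finite_words) auto
  ultimately show ?case
    using Cons by (simp add: card_image)
qed

fun weight :: "bool list \<Rightarrow> nat" where
  "weight [] = 0"
| "weight (x # xs) = (if x then Suc (weight xs) else weight xs)"

definition word_set :: "bool list \<Rightarrow> nat set" where
  "word_set xs = {i. i < length xs \<and> xs ! i}"

lemma card_word_set: "card (word_set xs) = weight xs"
proof -
  have "weight xs = length (filter (\<lambda>x. x) xs)" by (induction xs) auto
  then show ?thesis by (simp add: word_set_def length_filter_conv_card)
qed

lemma word_set_xor:
  "length xs = length ys \<Longrightarrow> word_set (xor_word xs ys) = sym_diff (word_set xs) (word_set ys)"
  by (auto simp: word_set_def)

lemma word_set_inj: "\<lbrakk>word_set xs = word_set ys; length xs = length ys\<rbrakk> \<Longrightarrow> xs = ys"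
  by (rule nth_equalityI) (auto simp: word_set_def set_eq_iff)

text \<open>
  The rows are the shifts of the generator polynomial \<open>1 + x\<^sup>2 + x\<^sup>4 + x\<^sup>5 + x\<^sup>6 + x\<^sup>1\<^sup>0 + x\<^sup>1\<^sup>1\<close>
  of the quadratic residue code of length 23, extended by a parity bit.
\<close>

definition golay_basis :: "bool list list" where
  "golay_basis = map (\<lambda>k. replicate k False
      @ [True, False, True, False, True, True, True, False, False, False, True, True]
      @ replicate (11 - k) False @ [True]) [0..<12]"

definition encode :: "bool list \<Rightarrow> bool list" where
  "encode u = combine u golay_basis (replicate 24 False)"

definition golay :: "nat set set" where
  "golay = (\<lambda>u. word_set (encode u)) ` {u. length u = 12}"

lemma length_golay_basis: "length golay_basis = 12" "\<forall>b\<in>set golay_basis. length b = 24"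
  by (auto simp: golay_basis_def)

lemma length_encode [simp]: "length (encode u) = 24"
  unfolding encode_def by (rule length_combine[OF length_golay_basis(2)]) simp

lemma encode_xor:
  assumes "length u = 12" "length v = 12"
  shows "encode (xor_word u v) = xor_word (encode u) (encode v)"
proof -
  have "xor_word (replicate 24 False) (replicate 24 False) = replicate 24 False"
    by (simp add: numeral_eq_Suc)
  then show ?thesis
    using combine_xor[of u golay_basis v 24 "replicate 24 False" "replicate 24 False"] assms
    by (simp add: encode_def length_golay_basis)
qed

lemma word_eval:
  "xor_word (True # xs) (True # ys) = False # xor_word xs ys"
  "xor_word (True # xs) (False # ys) = True # xor_word xs ys"
  "xor_word (False # xs) (True # ys) = True # xor_word xs ys"
  "xor_word (False # xs) (False # ys) = False # xor_word xs ys"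
  "xor_word [] [] = []"
  "weight [] = 0" "weight (True # xs) = Suc (weight xs)" "weight (False # xs) = weight xs"
  by simp_all

lemma golay_basis_eval: "golay_basis =
   [[True, False, True, False, True, True, True, False, False, False, True, True, False, False,
     False, False, False, False, False, False, False, False, False, True],
    [False, True, False, True, False, True, True, True, False, False, False, True, True, False,
     False, False, False, False, False, False, False, False, False, True],
    [False, False, True, False, True, False, True, True, True, False, False, False, True, True,
     False, False, False, False, False, False, False, False, False, True],
    [False, False, False, True, False, True, False, True, True, True, False, False, False, True,
     True, False, False, False, False, False, False, False, False, True],
    [False, False, False, False, True, False, True, False, True, True, True, False, False,
     False, True, True, False, False, False, False, False, False, False, True],
    [False, False, False, False, False, True, False, True, False, True, True, True, False,
     False, False, True, True, False, False, False, False, False, False, True],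
    [False, False, False, False, False, False, True, False, True, False, True, True, True,
     False, False, False, True, True, False, False, False, False, False, True],
    [False, False, False, False, False, False, False, True, False, True, False, True, True,
     True, False, False, False, True, True, False, False, False, False, True],
    [False, False, False, False, False, False, False, False, True, False, True, False, True,
     True, True, False, False, False, True, True, False, False, False, True],
    [False, False, False, False, False, False, False, False, False, True, False, True, False,
     True, True, True, False, False, False, True, True, False, False, True],
    [False, False, False, False, False, False, False, False, False, False, True, False, True,
     False, True, True, True, False, False, False, True, True, False, True],
    [False, False, False, False, False, False, False, False, False, False, False, True, False,
     True, False, True, True, True, False, False, False, True, True, True]]"
  by (simp add: golay_basis_def upt_rec numeral_eq_Suc)

lemma zero_word_eval: "replicate 24 False =
   [False, False, False, False, False, False, False, False, False, False, False, False, False,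
     False, False, False, False, False, False, False, False, False, False, False]"
  by (simp add: numeral_eq_Suc)

lemmas count_eval = golay_basis_eval zero_word_eval count_words.simps word_eval if_True if_False
  refl nat.distinct nat.inject add_0 add_0_right
lemmas to_Suc = numeral_eq_Suc pred_numeral_simps BitM.simps

lemmas count_weight_eval = count_eval arith_simps one_add_one numeral_plus_one one_plus_numeral

text \<open>The weight enumerator of the extended Golay code. The counts add up to
  \<open>4096 = 2^12\<close>, so no other weight occurs; minimum distance, injectivity of the
  encoding and even intersections are all drawn from these numbers.\<close>

lemma count_weight:
  "count_words (\<lambda>c. weight c = 0) golay_basis (replicate 24 False) = 1"
  "count_words (\<lambda>c. weight c = 8) golay_basis (replicate 24 False) = 759"
  "count_words (\<lambda>c. weight c = 12) golay_basis (replicate 24 False) = 2576"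
  "count_words (\<lambda>c. weight c = 16) golay_basis (replicate 24 False) = 759"
  "count_words (\<lambda>c. weight c = 24) golay_basis (replicate 24 False) = 1"
proof -
  \<comment> \<open>\<open>weight\<close> evaluates to a unary number, so against a unary target the
    equation is decided by injectivity and distinctness of \<open>Suc\<close>.\<close>
  have numerals: "(\<lambda>c. weight c = 8) = (\<lambda>c. weight c = Suc (Suc (Suc (Suc (Suc (Suc (Suc (Suc 0))))))))"
    "(\<lambda>c. weight c = 12) = (\<lambda>c. weight c = Suc (Suc (Suc (Suc (Suc (Suc (Suc (Suc
        (Suc (Suc (Suc (Suc 0))))))))))))"
    "(\<lambda>c. weight c = 16) = (\<lambda>c. weight c = Suc (Suc (Suc (Suc (Suc (Suc (Suc (Suc
        (Suc (Suc (Suc (Suc (Suc (Suc (Suc (Suc 0))))))))))))))))"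
    "(\<lambda>c. weight c = 24) = (\<lambda>c. weight c = Suc (Suc (Suc (Suc (Suc (Suc (Suc (Suc
        (Suc (Suc (Suc (Suc (Suc (Suc (Suc (Suc (Suc (Suc (Suc (Suc (Suc (Suc (Suc (Suc 0))))))))))))))))))))))))"
    by (simp_all only: to_Suc)
  show "count_words (\<lambda>c. weight c = 0) golay_basis (replicate 24 False) = 1"
    by (simp only: count_weight_eval)
  show "count_words (\<lambda>c. weight c = 8) golay_basis (replicate 24 False) = 759"
    unfolding numerals by (simp only: count_weight_eval)
  show "count_words (\<lambda>c. weight c = 12) golay_basis (replicate 24 False) = 2576"
    unfolding numerals by (simp only: count_weight_eval)
  show "count_words (\<lambda>c. weight c = 16) golay_basis (replicate 24 False) = 759"
    unfolding numerals by (simp only: count_weight_eval)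
  show "count_words (\<lambda>c. weight c = 24) golay_basis (replicate 24 False) = 1"
    unfolding numerals by (simp only: count_weight_eval)
qed

lemma count_encode:
  "count_words P golay_basis (replicate 24 False) = card {u. length u = 12 \<and> P (encode u)}"
  by (simp add: count_words length_golay_basis encode_def)

lemma weight_xor_self: "weight (xor_word w w) = 0"
  by (induction w) auto

text \<open>The encoding is linear over the field with two elements, and its kernel is trivial
  because exactly one coefficient vector gives weight 0.\<close>

lemma encode_inj: "inj_on encode {u. length u = 12}"
proof (rule inj_onI)
  fix u v :: "bool list"
  assume "u \<in> {u. length u = 12}" "v \<in> {u. length u = 12}" and eq: "encode u = encode v"
  then have len: "length u = 12" "length v = 12" by simp_all
  let ?Z = "{u. length u = 12 \<and> weight (encode u) = 0}"
  have "card ?Z = 1"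
    using count_weight(1) by (simp only: count_encode)
  then obtain z where z: "?Z = {z}"
    by (rule card_1_singletonE)
  have "xor_word u v \<in> ?Z" "xor_word u u \<in> ?Z"
    using len by (simp_all add: encode_xor eq weight_xor_self)
  then have self: "xor_word u v = xor_word u u"
    unfolding z by simp
  show "u = v"
  proof (rule nth_equalityI)
    fix i assume "i < length u"
    then show "u ! i = v ! i"
      using len nth_xor_word[of i u v] nth_xor_word[of i u u] by (simp add: self)
  qed (simp add: len)
qed

lemma golay_word_inj: "inj_on (\<lambda>u. word_set (encode u)) {u. length u = 12}"
  using encode_inj by (auto simp: inj_on_def dest: word_set_inj)

lemma golay_encode: "length u = 12 \<Longrightarrow> word_set (encode u) \<in> golay"
  by (auto simp: golay_def)

lemma golay_subset: "C \<in> golay \<Longrightarrow> C \<subseteq> {..<24}"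
  by (auto simp: golay_def word_set_def)

lemma golay_finite: "C \<in> golay \<Longrightarrow> finite C"
  using golay_subset finite_subset by blast

lemma golay_sym_diff:
  assumes "C \<in> golay" "D \<in> golay" shows "sym_diff C D \<in> golay"
proof -
  obtain u v where uv: "length u = 12" "length v = 12" "C = word_set (encode u)" "D = word_set (encode v)"
    using assms by (auto simp: golay_def)
  then have "sym_diff C D = word_set (encode (xor_word u v))"
    using word_set_xor[of "encode u" "encode v"] by (simp add: encode_xor)
  then show ?thesis
    using uv golay_encode[of "xor_word u v"] by simp
qed

lemma golay_weights:
  assumes "C \<in> golay" shows "card C \<in> {0, 8, 12, 16, 24}"
proof -
  let ?W = "\<lambda>k. {u. length u = 12 \<and> weight (encode u) = k}"
  let ?K = "{0, 8, 12, 16, 24 :: nat}"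
  \<comment> \<open>The five weight classes are disjoint and together as numerous as all coefficient
    vectors, so they exhaust them.\<close>
  have "card (\<Union>k\<in>?K. ?W k) = (\<Sum>k\<in>?K. card (?W k))"
    by (intro card_UN_disjoint) (auto simp: finite_words)
  also have "\<dots> = 4096"
    using count_weight by (simp add: count_encode)
  also have "\<dots> = card {u :: bool list. length u = 12}"
    using card_lists_length_eq[of "UNIV :: bool set" 12] by simp
  finally have "(\<Union>k\<in>?K. ?W k) = {u. length u = 12}"
    using finite_words[of 12 "\<lambda>_. True"] by (intro card_subset_eq) auto
  moreover obtain u where u: "u \<in> {u. length u = 12}" "C = word_set (encode u)"
    using assms by (auto simp: golay_def)
  ultimately have "u \<in> (\<Union>k\<in>?K. ?W k)"
    by simp
  then show ?thesis
    by (auto simp: u(2) card_word_set)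
qed

lemma card_golay: "card golay = 4096"
  using card_lists_length_eq[of "UNIV :: bool set" 12]
  by (simp add: golay_def card_image[OF golay_word_inj])

lemma card_octads: "card {C \<in> golay. card C = 8} = 759"
proof -
  have "{C \<in> golay. card C = 8} = (\<lambda>u. word_set (encode u)) ` {u. length u = 12 \<and> weight (encode u) = 8}"
    by (auto simp: golay_def card_word_set)
  moreover have "inj_on (\<lambda>u. word_set (encode u)) {u. length u = 12 \<and> weight (encode u) = 8}"
    using golay_word_inj by (rule inj_on_subset) auto
  ultimately show ?thesis
    using count_weight(2) count_encode[of "\<lambda>c. weight c = 8"] by (simp add: card_image)
qed

lemma golay_empty: "{} \<in> golay"
proof -
  have "sym_diff C C = {}" for C :: "nat set" by simp
  moreover have "word_set (encode (replicate 12 False)) \<in> golay"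
    by (rule golay_encode) simp
  ultimately show ?thesis
    using golay_sym_diff by metis
qed

lemma card_sym_diff:
  assumes "finite A" "finite B"
  shows "card (sym_diff A B) + 2 * card (A \<inter> B) = card A + card B"
proof -
  have "card (sym_diff A B) = card (A - B) + card (B - A)"
    using assms by (intro card_Un_disjoint) auto
  moreover have "card A = card (A - B) + card (A \<inter> B)" "card B = card (B - A) + card (A \<inter> B)"
    using assms card_Int_Diff[of A B] card_Int_Diff[of B A] by (auto simp: Int_commute)
  ultimately show ?thesis by simp
qed

text \<open>Twice the size of the intersection is \<open>card C + card D\<close> minus the weight of
  the sum, and all three weights are multiples of 4.\<close>

lemma golay_even_inter:
  assumes "C \<in> golay" "D \<in> golay" shows "even (card (C \<inter> D))"
proof -
  have four: "4 dvd card E" if "E \<in> golay" for E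
    using golay_weights[OF that] by (elim insertE emptyE; simp only:) simp_all
  have "card (sym_diff C D) + 2 * card (C \<inter> D) = card C + card D"
    by (intro card_sym_diff golay_finite assms)
  with four[OF assms(1)] four[OF assms(2)] four[OF golay_sym_diff[OF assms]]
  show ?thesis by presburger
qed

section \<open>Minimal vectors of the Leech lattice\<close>

text \<open>The Leech lattice in its usual integral coordinates, enlarged by the factor
  \<open>sqrt 8\<close>, so that the minimal norm 4 becomes 32. Letting \<open>m\<close> be any
  integer instead of a parity makes closure under differences immediate.\<close>

definition leech :: "(nat \<Rightarrow> int) set" where
  "leech = {x. \<exists>m C y. C \<in> golay \<and> (\<forall>i<24. x i = m + 2 * of_bool (i \<in> C) + 4 * y i)
     \<and> 8 dvd (\<Sum>i<24. x i) - 4 * m}"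

lemma leechI:
  assumes "C \<in> golay" "\<And>i. i < 24 \<Longrightarrow> x i = m + 2 * of_bool (i \<in> C) + 4 * y i"
    "8 dvd (\<Sum>i<24. x i) - 4 * m"
  shows "x \<in> leech"
  unfolding leech_def using assms by blast

lemma leech_diff:
  assumes "x \<in> leech" "x' \<in> leech" shows "(\<lambda>i. x i - x' i) \<in> leech"
proof -
  obtain m C y where x: "C \<in> golay" "\<forall>i<24. x i = m + 2 * of_bool (i \<in> C) + 4 * y i"
    "8 dvd (\<Sum>i<24. x i) - 4 * m"
    using assms(1) unfolding leech_def by blast
  obtain m' C' y' where x': "C' \<in> golay" "\<forall>i<24. x' i = m' + 2 * of_bool (i \<in> C') + 4 * y' i"
    "8 dvd (\<Sum>i<24. x' i) - 4 * m'"
    using assms(2) unfolding leech_def by blast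
  \<comment> \<open>The difference of two indicators is the indicator of the symmetric difference
    minus twice that of \<open>C' - C\<close>; the latter is the carry into the multiples of
    4.\<close>
  have 1: "x i - x' i = (m - m') + 2 * of_bool (i \<in> sym_diff C C')
      + 4 * (y i - y' i - of_bool (i \<in> C' - C))" if "i < 24" for i
    using x(2) x'(2) that by auto
  have "(\<Sum>i<24. x i - x' i) - 4 * (m - m')
      = ((\<Sum>i<24. x i) - 4 * m) - ((\<Sum>i<24. x' i) - 4 * m')"
    by (simp add: sum_subtractf algebra_simps)
  then have 2: "8 dvd (\<Sum>i<24. x i - x' i) - 4 * (m - m')"
    using x(3) x'(3) by (simp only: dvd_diff)
  show ?thesis
    by (rule leechI[OF golay_sym_diff[OF x(1) x'(1)] 1 2])
qed

lemma sum_ge_on: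
  fixes f :: "nat \<Rightarrow> int"
  assumes "finite A" "B \<subseteq> A" "\<And>i. i \<in> A \<Longrightarrow> 0 \<le> f i" "\<And>i. i \<in> B \<Longrightarrow> c \<le> f i"
  shows "c * int (card B) \<le> sum f A"
proof -
  have "c * int (card B) = (\<Sum>i\<in>B. c)" by simp
  also have "\<dots> \<le> sum f B" using assms by (intro sum_mono) auto
  also have "\<dots> \<le> sum f A" using assms by (intro sum_mono2) auto
  finally show ?thesis .
qed

lemma square_ge: "c \<le> \<bar>z\<bar> \<Longrightarrow> 0 \<le> c \<Longrightarrow> c^2 \<le> z^2" for c z :: int
  using power_mono[of c "\<bar>z\<bar>" 2] by simp

lemma golay_twice_card: "C \<in> golay \<Longrightarrow> 8 dvd 2 * int (card C)"
  using golay_weights[of C] by auto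

text \<open>The values 1 and -1 differ modulo 4, so \<open>m mod 4\<close> and the membership bit
  determine which one occurs.\<close>

lemma odd_residue:
  fixes x m y :: int
  assumes "x = m + 2 * of_bool b + 4 * y" "odd m" "x = 1 \<or> x = -1"
  shows "x = (if m mod 4 = 1 then 1 else -1) * (1 - 2 * of_bool b)"
proof (cases b)
  case True
  then have "m = x - 2 - 4 * y" using assms(1) by simp
  then show ?thesis using assms(3) True by (elim disjE; simp) presburger+
next
  case False
  then have "m = x - 4 * y" using assms(1) by simp
  then show ?thesis using assms(3) False by (elim disjE; simp) presburger+
qed

lemma even_residue:
  fixes x m y :: int
  assumes "x = m + 2 * of_bool b + 4 * y" "even m"
  shows "x mod 4 = 2 \<longleftrightarrow> (b \<longleftrightarrow> 4 dvd m)"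
proof (cases b)
  case True
  then have "x = m + 2 + 4 * y" using assms(1) by simp
  then show ?thesis using assms(2) True by simp presburger
next
  case False
  then have "x = m + 4 * y" using assms(1) by simp
  then show ?thesis using assms(2) False by simp presburger
qed

lemma sum_of_bool: "C \<subseteq> {..<24 :: nat} \<Longrightarrow> (\<Sum>i<24. of_bool (i \<in> C)) = int (card C)"
  by (simp add: sum.If_cases of_bool_def Int_absorb1)

lemma small_residues:
  fixes z :: int
  shows "z mod 4 = 2 \<Longrightarrow> 2 \<le> \<bar>z\<bar>" "even z \<Longrightarrow> z mod 4 \<noteq> 2 \<Longrightarrow> 4 dvd z"
    "\<bar>z\<bar> < 3 \<Longrightarrow> odd z \<Longrightarrow> z = 1 \<or> z = -1" "8 dvd 4 * z \<Longrightarrow> even z"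
    "8 dvd w - 4 * z \<Longrightarrow> even z \<Longrightarrow> 8 dvd w"
  by presburger+

text \<open>For odd \<open>m\<close> all coordinates are odd. One of modulus at least 3 gives 9 + 23
  = 32; if all were 1 or -1, the sum would be a multiple of 8 although it is 4 modulo 8. For even
  \<open>m\<close> the coordinates that are 2 modulo 4 form \<open>C\<close> or its complement: if
  there are any, there are at least 8, giving 8 * 4. Otherwise all are multiples of 4, and either
  two nonzero ones give 2 * 16, or a single one is a multiple of 8 and gives 64.\<close>

lemma leech_norm:
  assumes "x \<in> leech" "a < 24" "x a \<noteq> 0"
  shows "32 \<le> (\<Sum>i<24. (x i)^2)"
proof -
  obtain m C y where C: "C \<in> golay" and x: "\<And>i. i < 24 \<Longrightarrow> x i = m + 2 * of_bool (i \<in> C) + 4 * y i"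
    and total: "8 dvd (\<Sum>i<24. x i) - 4 * m"
    using assms(1) unfolding leech_def by blast
  have CN: "C \<subseteq> {..<24}" by (rule golay_subset[OF C])
  have weight8: "card D = 0 \<or> 8 \<le> card D" if "D = C \<or> D = {..<24} - C" for D
  proof -
    have "card ({..<24} - C) = 24 - card C"
      using CN by (simp add: card_Diff_subset golay_finite[OF C])
    then show ?thesis using that golay_weights[OF C] by auto
  qed
  show ?thesis
  proof (cases "even m")
    case False
    then have odd: "odd (x i)" if "i < 24" for i using x[OF that] by simp
    show ?thesis
    proof (cases "\<exists>b<24. 3 \<le> \<bar>x b\<bar>")
      case True
      then obtain b where b: "b < 24" "3 \<le> \<bar>x b\<bar>" by auto
      have "1 \<le> (x i)^2" if "i < 24" for i
        using square_ge[of 1 "x i"] odd[OF that] by (cases "x i = 0") auto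
      then have "1 * int (card ({..<24} - {b})) \<le> (\<Sum>i\<in>{..<24} - {b}. (x i)^2)"
        by (intro sum_ge_on) auto
      moreover have "9 \<le> (x b)^2" using square_ge[OF b(2)] by simp
      moreover have "(\<Sum>i<24. (x i)^2) = (x b)^2 + (\<Sum>i\<in>{..<24} - {b}. (x i)^2)"
        using b by (intro sum.remove) auto
      ultimately show ?thesis using b by simp
    next
      case False
      have unit: "x i = 1 \<or> x i = -1" if "i < 24" for i
      proof -
        have "\<bar>x i\<bar> < 3" using False that by (simp add: not_le)
        then show ?thesis using odd[OF that] by (rule small_residues(3))
      qed
      define s :: int where "s = (if m mod 4 = 1 then 1 else -1)"
      have s: "x i = s * (1 - 2 * of_bool (i \<in> C))" if "i < 24" for i
        unfolding s_def by (rule odd_residue[OF x[OF that] \<open>odd m\<close> unit[OF that]])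
      have "(\<Sum>i<24. of_bool (i \<in> C)) = int (card C)"
        by (rule sum_of_bool[OF CN])
      moreover have "(\<Sum>i<24. x i) = (\<Sum>i<24. s * (1 - 2 * of_bool (i \<in> C)))"
        by (rule sum.cong) (simp_all only: s lessThan_iff)
      moreover have "\<dots> = s * (24 - 2 * (\<Sum>i<24. of_bool (i \<in> C)))"
        by (simp only: sum_distrib_left[symmetric] sum_subtractf) simp
      ultimately have "(\<Sum>i<24. x i) = s * (24 - 2 * int (card C))"
        by (simp only:)
      moreover have "8 dvd s * (24 - 2 * int (card C))"
        by (intro dvd_mult dvd_diff golay_twice_card[OF C]) simp
      ultimately have "8 dvd (\<Sum>i<24. x i)" by simp
      then have "8 dvd (\<Sum>i<24. x i) - ((\<Sum>i<24. x i) - 4 * m)"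
        by (rule dvd_diff[OF _ total])
      then have "8 dvd 4 * m" by simp
      then show ?thesis using small_residues(4) \<open>odd m\<close> by blast
    qed
  next
    case even: True
    define D where "D = {i\<in>{..<24}. x i mod 4 = 2}"
    have "x i mod 4 = 2 \<longleftrightarrow> (i \<in> C \<longleftrightarrow> 4 dvd m)" if "i < 24" for i
      by (rule even_residue[OF x[OF that] even])
    then have "D = C \<or> D = {..<24} - C"
      using CN by (cases "4 dvd m") (auto simp: D_def)
    then have "card D = 0 \<or> 8 \<le> card D" by (rule weight8)
    then consider "8 \<le> card D" | "card D = 0" by (elim disjE) auto
    then show ?thesis
    proof cases
      case 1
      have "4 \<le> (x i)^2" if "i \<in> D" for i
      proof -
        have "2 \<le> \<bar>x i\<bar>" using that by (intro small_residues(1)) (simp add: D_def)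
        then show ?thesis using square_ge[of 2 "x i"] by simp
      qed
      then have "4 * int (card D) \<le> (\<Sum>i<24. (x i)^2)"
        by (intro sum_ge_on) (auto simp: D_def)
      then show ?thesis using 1 by simp
    next
      case 2
      then have "D = {}" by (simp add: D_def)
      have four: "4 dvd x i" if "i < 24" for i
      proof -
        have "even (x i)" using x[OF that] even by simp
        moreover have "x i mod 4 \<noteq> 2" using \<open>D = {}\<close> that by (auto simp: D_def)
        ultimately show ?thesis by (rule small_residues(2))
      qed
      have big: "16 \<le> (x i)^2" if "i < 24" "x i \<noteq> 0" for i
      proof -
        have "4 \<le> \<bar>x i\<bar>" using dvd_imp_le_int[OF that(2) four[OF that(1)]] by simp
        then show ?thesis using square_ge[of 4 "x i"] by simp
      qed
      show ?thesis
      proof (cases "\<exists>b<24. b \<noteq> a \<and> x b \<noteq> 0")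
        case True
        then obtain b where b: "b < 24" "b \<noteq> a" "x b \<noteq> 0" by auto
        have "16 * int (card {a, b}) \<le> (\<Sum>i<24. (x i)^2)"
          using assms b big by (intro sum_ge_on) auto
        then show ?thesis using b by simp
      next
        case False
        then have "(\<Sum>i<24. x i) = (\<Sum>i\<in>{a}. x i)"
          using assms by (intro sum.mono_neutral_right) auto
        then have "8 dvd x a - 4 * m" using total by simp
        then have "8 dvd x a" using even by (rule small_residues(5))
        then have "8 \<le> \<bar>x a\<bar>" using dvd_imp_le_int[OF assms(3)] by fastforce
        then have "64 \<le> (x a)^2" using square_ge[of 8 "x a"] by simp
        moreover have "(x a)^2 \<le> (\<Sum>i<24. (x i)^2)"
          using assms by (intro member_le_sum) auto
        ultimately show ?thesis by simp
      qed
    qed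
  qed
qed

section \<open>The minimal vectors: inner products and number\<close>

definition min_vecs :: "(nat \<Rightarrow> int) set" where
  "min_vecs = {x \<in> leech. (\<forall>i\<ge>24. x i = 0) \<and> (\<Sum>i<24. (x i)^2) = 32}"

text \<open>The difference of two minimal vectors is a nonzero lattice vector, so
  \<open>64 - 2 * (x, y)\<close> is at least 32.\<close>

lemma min_vecs_inner:
  assumes "x \<in> min_vecs" "y \<in> min_vecs" "x \<noteq> y"
  shows "(\<Sum>i<24. x i * y i) \<le> 16"
proof -
  obtain a where "x a \<noteq> y a" using assms(3) by auto
  moreover from this have "a < 24"
    using assms(1,2) by (cases "a < 24") (auto simp: min_vecs_def)
  ultimately have "32 \<le> (\<Sum>i<24. (x i - y i)^2)"
    using assms leech_norm[OF leech_diff, of x y a] by (auto simp: min_vecs_def)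
  also have "\<dots> = (\<Sum>i<24. (x i)^2) + (\<Sum>i<24. (y i)^2) - 2 * (\<Sum>i<24. x i * y i)"
    by (simp add: power2_diff sum.distrib sum_subtractf sum_distrib_left mult.assoc)
  finally show ?thesis using assms by (simp add: min_vecs_def)
qed

lemma finite_min_vecs: "finite min_vecs"
proof (rule finite_subset)
  show "min_vecs \<subseteq> {x. \<forall>i. (i \<in> {..<24} \<longrightarrow> x i \<in> {-32..32}) \<and> (i \<notin> {..<24} \<longrightarrow> x i = 0)}"
  proof (clarsimp simp: min_vecs_def)
    fix x :: "nat \<Rightarrow> int" and i :: nat
    assume "(\<Sum>i<24. (x i)^2) = 32" "i < 24"
    then have "(x i)^2 \<le> 32" using member_le_sum[of i "{..<24}" "\<lambda>i. (x i)^2"] by auto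
    have "\<bar>x i\<bar> \<le> 32"
    proof (cases "x i = 0")
      case False
      then have "\<bar>x i\<bar> \<le> \<bar>x i\<bar>^2" by (intro self_le_power) auto
      then show ?thesis using \<open>(x i)^2 \<le> 32\<close> by simp
    qed simp
    then show "- 32 \<le> x i \<and> x i \<le> 32" by auto
  qed
  show "finite {x. \<forall>i. (i \<in> {..<24} \<longrightarrow> x i \<in> {- 32..32 :: int}) \<and> (i \<notin> {..<24 :: nat} \<longrightarrow> x i = 0)}"
    by (rule finite_set_of_finite_funs) auto
qed

definition signed :: "int \<Rightarrow> nat set \<Rightarrow> nat set \<Rightarrow> nat \<Rightarrow> int" where
  "signed a K s i = (if i \<in> K then if i \<in> s then - a else a else 0)"

definition odd_vec :: "nat set \<Rightarrow> nat \<Rightarrow> nat \<Rightarrow> int" where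
  "odd_vec C k i = (if i < 24 then (if i \<in> C then -1 else 1) * (if i = k then -3 else 1) else 0)"

lemma sum_signed:
  assumes "K \<subseteq> {..<24}" "s \<subseteq> K"
  shows "(\<Sum>i<24. signed a K s i) = a * int (card K) - 2 * a * int (card s)"
    "(\<Sum>i<24. (signed a K s i)^2) = a^2 * int (card K)"
proof -
  have "signed a K s i = a * of_bool (i \<in> K) - 2 * a * of_bool (i \<in> s)" for i
    using assms(2) by (auto simp: signed_def)
  then have "(\<Sum>i<24. signed a K s i) = a * (\<Sum>i<24. of_bool (i \<in> K)) - 2 * a * (\<Sum>i<24. of_bool (i \<in> s))"
    by (simp add: sum_subtractf sum_distrib_left)
  then show "(\<Sum>i<24. signed a K s i) = a * int (card K) - 2 * a * int (card s)"
    using assms sum_of_bool[of K] sum_of_bool[of s] by (metis order_trans)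
  have "(signed a K s i)^2 = a^2 * of_bool (i \<in> K)" for i
    by (simp add: signed_def)
  then have "(\<Sum>i<24. (signed a K s i)^2) = a^2 * (\<Sum>i<24. of_bool (i \<in> K))"
    by (simp add: sum_distrib_left)
  then show "(\<Sum>i<24. (signed a K s i)^2) = a^2 * int (card K)"
    using sum_of_bool[OF assms(1)] by simp
qed

lemma signed_octad:
  assumes "C \<in> golay" "card C = 8" "s \<subseteq> C" "even (card s)"
  shows "signed 2 C s \<in> min_vecs"
proof -
  have C: "C \<subseteq> {..<24}" using assms(1) by (rule golay_subset)
  have "signed 2 C s i = 0 + 2 * of_bool (i \<in> C) + 4 * (- of_bool (i \<in> s))" for i
    using assms(3) by (auto simp: signed_def)
  \<comment> \<open>The sum is \<open>16 - 4 * card s\<close>; this is where an even number of minus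
    signs is needed.\<close>
  moreover have "8 dvd (\<Sum>i<24. signed 2 C s i) - 4 * 0"
    using assms(4) by (auto simp: sum_signed(1)[OF C assms(3)] assms(2) elim!: evenE)
  ultimately have "signed 2 C s \<in> leech"
    by (rule leechI[OF assms(1)])
  then show ?thesis
    using sum_signed(2)[OF C assms(3)] assms(2) C by (auto simp: min_vecs_def signed_def)
qed

lemma signed_pair:
  assumes "K \<subseteq> {..<24}" "card K = 2" "s \<subseteq> K"
  shows "signed 4 K s \<in> min_vecs"
proof -
  have "signed 4 K s i = 0 + 2 * of_bool (i \<in> {}) + 4 * (signed 1 K s i)" for i
    by (auto simp: signed_def)
  moreover have "8 dvd (\<Sum>i<24. signed 4 K s i) - 4 * 0"
    by (simp add: sum_signed(1)[OF assms(1,3)] assms(2))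
  ultimately have "signed 4 K s \<in> leech"
    by (rule leechI[OF golay_empty])
  then show ?thesis
    using sum_signed(2)[OF assms(1,3)] assms(1,2) by (auto simp: min_vecs_def signed_def)
qed

lemma odd_vec_min:
  assumes "C \<in> golay" "k < 24"
  shows "odd_vec C k \<in> min_vecs"
proof -
  have C: "C \<subseteq> {..<24}" using assms(1) by (rule golay_subset)
  \<comment> \<open>With \<open>m = 1\<close> the four possible entries are 1 = 1, -1 = 1 + 2 - 4,
    -3 = 1 - 4 and 3 = 1 + 2.\<close>
  have "odd_vec C k i = 1 + 2 * of_bool (i \<in> C) + 4 * (- of_bool ((i \<in> C) \<noteq> (i = k)))" if "i < 24" for i
    using that by (auto simp: odd_vec_def)
  moreover have "8 dvd (\<Sum>i<24. odd_vec C k i) - 4 * 1"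
  proof -
    have "(\<Sum>i<24. odd_vec C k i)
        = (\<Sum>i<24. (1 - 2 * of_bool (i \<in> C)) - (if i = k then 4 - 8 * of_bool (k \<in> C) else 0))"
      by (intro sum.cong) (auto simp: odd_vec_def)
    also have "\<dots> = 24 - 2 * int (card C) - (4 - 8 * of_bool (k \<in> C))"
      using assms(2) sum_of_bool[OF C]
      by (simp add: sum_subtractf sum_distrib_left[symmetric])
    finally have eq: "(\<Sum>i<24. odd_vec C k i) - 4 * 1 = 16 - 2 * int (card C) + 8 * of_bool (k \<in> C)"
      by simp
    show ?thesis
      unfolding eq by (intro dvd_add dvd_diff golay_twice_card[OF assms(1)]) simp_all
  qed
  ultimately have "odd_vec C k \<in> leech"
    by (rule leechI[OF assms(1)])
  moreover have "(\<Sum>i<24. (odd_vec C k i)^2) = (\<Sum>i<24. 1 + (if i = k then 8 else 0))"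
    by (intro sum.cong) (auto simp: odd_vec_def)
  ultimately show ?thesis
    using assms(2) by (auto simp: min_vecs_def odd_vec_def sum.distrib)
qed

lemma signed_inj:
  assumes "signed a K s = signed a K' s'" "s \<subseteq> K" "s' \<subseteq> K'" "a \<noteq> 0"
  shows "K = K' \<and> s = s'"
proof -
  have "i \<in> K \<longleftrightarrow> signed a K s i \<noteq> 0" "i \<in> s \<longleftrightarrow> signed a K s i = - a"
    "i \<in> K' \<longleftrightarrow> signed a K' s' i \<noteq> 0" "i \<in> s' \<longleftrightarrow> signed a K' s' i = - a" for i
    using assms(2-4) by (auto simp: signed_def)
  then show ?thesis using assms(1) by (auto simp: set_eq_iff)
qed

text \<open>Every subset of \<open>K - {a}\<close> becomes even by adding \<open>a\<close> if
  necessary, and removing \<open>a\<close> recovers it.\<close>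

lemma card_even_subsets:
  assumes "finite K" "a \<in> K"
  shows "2 ^ (card K - 1) \<le> card {s. s \<subseteq> K \<and> even (card s)}"
proof -
  let ?f = "\<lambda>s. if even (card s) then s else insert a s"
  have "inj_on ?f (Pow (K - {a}))"
    by (rule inj_on_inverseI[where g = "\<lambda>s. s - {a}"]) auto
  moreover have "?f ` Pow (K - {a}) \<subseteq> {s. s \<subseteq> K \<and> even (card s)}"
  proof (intro image_subsetI)
    fix s assume "s \<in> Pow (K - {a})"
    then have "s \<subseteq> K" "a \<notin> s" "finite s" using assms finite_subset by auto
    then show "?f s \<in> {s. s \<subseteq> K \<and> even (card s)}" using assms(2) by auto
  qed
  moreover have "finite {s. s \<subseteq> K \<and> even (card s)}" using assms(1) by simp
  ultimately have "card (Pow (K - {a})) \<le> card {s. s \<subseteq> K \<and> even (card s)}"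
    by (rule card_inj_on_le)
  then show ?thesis using assms by (simp add: card_Pow)
qed

text \<open>The three shapes contribute 759 * 128 (entries 2 and -2 on an octad), 276 * 4 (two
  entries 4 or -4) and 4096 * 24 (one entry 3 or -3, the others 1 or -1). Only the lower bound is
  required, so completeness of the list of shapes need not be shown.\<close>

lemma card_min_vecs: "196560 \<le> card min_vecs"
proof -
  let ?O = "{C \<in> golay. card C = 8}" and ?P = "{K. K \<subseteq> {..<24 :: nat} \<and> card K = 2}"
  let ?E = "\<lambda>K :: nat set. {s. s \<subseteq> K \<and> even (card s)}"
  let ?A = "case_prod (signed 2) ` (SIGMA C:?O. ?E C)"
  let ?B = "case_prod (signed 4) ` (SIGMA K:?P. Pow K)"
  let ?C = "case_prod odd_vec ` (golay \<times> {..<24})"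
  have fin: "finite ?O" "finite ?P"
    by (rule card_ge_0_finite, simp add: card_octads) (rule finite_subset[of _ "Pow {..<24}"], auto)
  have finP: "finite K" if "K \<in> ?P" for K using that by (intro card_ge_0_finite) simp
  have finK: "finite C" if "C \<in> ?O" for C using that by (simp add: golay_finite)
  have "(\<Sum>C\<in>?O. 2 ^ (card C - 1)) = (\<Sum>C\<in>?O. 128 :: nat)"
    by (intro sum.cong) auto
  also have "\<dots> = 97152"
    unfolding sum_constant card_octads by simp
  finally have "97152 = (\<Sum>C\<in>?O. 2 ^ (card C - 1) :: nat)" by (rule sym)
  also have "\<dots> \<le> (\<Sum>C\<in>?O. card (?E C))"
  proof (rule sum_mono)
    fix C assume "C \<in> ?O"
    then have "finite C" and "card C = 8" by (simp_all add: golay_finite)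
    then obtain a where "a \<in> C" by (metis card.empty ex_in_conv zero_neq_numeral)
    then show "2 ^ (card C - 1) \<le> card (?E C)" by (rule card_even_subsets[OF \<open>finite C\<close>])
  qed
  also have "\<dots> = card (SIGMA C:?O. ?E C)"
    by (rule card_SigmaI[symmetric], rule fin(1), intro ballI, drule finK, simp)
  also have "\<dots> = card ?A"
    by (intro card_image[symmetric] inj_onI) (auto dest: signed_inj)
  finally have A: "97152 \<le> card ?A" .
  have "card ?P = 276" by (simp add: n_subsets choose_two)
  then have "(1104 :: nat) = (\<Sum>K\<in>?P. 2 ^ card K)" by simp
  also have "\<dots> = (\<Sum>K\<in>?P. card (Pow K))"
    by (rule sum.cong, rule refl, rule card_Pow[symmetric], erule finP)
  also have "\<dots> = card (SIGMA K:?P. Pow K)"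
    by (rule card_SigmaI[symmetric], rule fin(2), intro ballI, drule finP, simp)
  also have "\<dots> = card ?B"
    by (intro card_image[symmetric] inj_onI) (auto dest: signed_inj)
  finally have B: "1104 = card ?B" .
  have "inj_on (case_prod odd_vec) (golay \<times> {..<24})"
  proof (rule inj_onI, clarsimp)
    fix C k C' k'
    assume *: "C \<in> golay" "C' \<in> golay" "k < 24" "k' < 24" "odd_vec C k = odd_vec C' k'"
    have "k = k'"
      using fun_cong[OF *(5), of k] *(3,4) by (auto simp: odd_vec_def split: if_splits)
    moreover have "i \<in> C \<longleftrightarrow> i \<in> C'" if "i < 24" for i
      using fun_cong[OF *(5), of i] that \<open>k = k'\<close> by (auto simp: odd_vec_def split: if_splits)
    then have "C = C'" using golay_subset[OF *(1)] golay_subset[OF *(2)] by auto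
    ultimately show "C = C' \<and> k = k'" by simp
  qed
  then have C: "card ?C = 98304"
    by (simp add: card_image card_cartesian_product card_golay)
  have finABC: "finite ?A" "finite ?B" "finite ?C"
    by (rule card_ge_0_finite; use A B C in linarith)+
  have AB: "?A \<inter> ?B = {}"
  proof (rule ccontr)
    assume "?A \<inter> ?B \<noteq> {}"
    then obtain D s K t where *: "signed 2 D s = signed 4 K t" "card K = 2" by auto
    then obtain i where "i \<in> K" by fastforce
    then show False using fun_cong[OF *(1), of i] by (auto simp: signed_def split: if_splits)
  qed
  have "even (x 0)" if "x \<in> ?A \<union> ?B" for x
    using that by (auto simp: signed_def)
  moreover have "odd (x 0)" if "x \<in> ?C" for x
    using that by (auto simp: odd_vec_def split: if_splits)
  ultimately have ABC: "(?A \<union> ?B) \<inter> ?C = {}" by blast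
  have "card (?A \<union> ?B \<union> ?C) = card ?A + card ?B + card ?C"
    using card_Un_disjoint[OF _ finABC(3) ABC] card_Un_disjoint[OF finABC(1,2) AB] finABC by simp
  moreover have "?A \<union> ?B \<union> ?C \<subseteq> min_vecs"
    using signed_octad signed_pair odd_vec_min by auto
  then have "card (?A \<union> ?B \<union> ?C) \<le> card min_vecs"
    by (rule card_mono[OF finite_min_vecs])
  ultimately show ?thesis using A B C by simp
qed

section \<open>A code of 498 minimal vectors\<close>

definition vec_of :: "int list \<Rightarrow> nat \<Rightarrow> int" where
  "vec_of xs i = (if i < length xs then xs ! i else 0)"

fun signs :: "bool list \<Rightarrow> int list \<Rightarrow> int list" where
  "signs (s # w) (x # xs) = (if s then - x else x) # signs w xs"
| "signs _ _ = []"

fun bits :: "nat \<Rightarrow> nat \<Rightarrow> bool list" where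
  "bits 0 n = []"
| "bits (Suc k) n = odd n # bits k (n div 2)"

definition word :: "nat \<Rightarrow> bool list" where
  "word n = encode (bits 12 n)"

definition odd_base :: "nat \<Rightarrow> int list" where
  "odd_base k = (replicate 24 1)[k := -3]"

definition octad_base :: "nat \<Rightarrow> int list" where
  "octad_base n = map (\<lambda>b. if b then 2 else 0) (word n)"

definition pair_base :: "nat \<Rightarrow> nat \<Rightarrow> int list" where
  "pair_base j k = (replicate 24 0)[j := 4, k := 4]"

text \<open>
  The code below is a spherical code of 498 minimal vectors with pairwise inner products at most
  \<open>8\<close>. It was found by a computer search for unions of orbits of subgroups of order 12 of
  the Conway group \<open>Co\<^sub>0\<close>. A number \<open>n < 4096\<close> stands for the Golay codeword with
  coefficient vector \<open>bits 12 n\<close>; an entry \<open>(b, ns)\<close> stands for the vectors obtained from \<open>b\<close>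
  by changing signs on the codewords \<open>ns\<close>.
\<close>

definition odd_data :: "(nat \<times> nat list) list" where
  "odd_data =
   [(0, [5, 23, 952, 1280, 1335, 1529, 1868, 2046, 2395, 2790, 2804, 3357, 3503, 4052, 4067]),
   (1, [246, 744, 1710, 2130, 2177]), (2, [10, 57, 836, 925, 1126, 1532, 1732, 2430, 2471, 2778,
   2793, 3111, 3717, 3871]), (3, [375, 1077, 1490, 1865, 2372, 3498, 3521, 3798, 4028]), (4, [95,
   637, 1065, 1166, 1511, 1960, 2225, 3124, 3256, 3403, 3786]), (5, [250, 582, 1039, 2213, 2568,
   3225, 3332]), (6, [277, 443, 455, 1204, 1755, 1914, 2905, 3062, 3481, 3504]), (7, [910, 1334,
   2413, 2425, 2830, 4053]), (8, [197, 838, 1278, 2511, 2598, 2993, 3250, 3613]), (9, [216, 724,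
   1530, 1850, 2103, 2619, 3170, 3545, 3841]), (10, [316, 611, 675, 1445, 1699, 2112, 2253, 3730,
   3887, 3910]), (11, [499, 656, 1325, 1550, 1984, 2163, 2382, 3309]), (12, [56, 406, 561, 749,
   823, 915, 1025, 1161, 1302, 1653, 2062, 2258, 2416, 2516, 2779, 3306, 3690, 4085]), (13, [21,
   360, 572, 982, 997, 1934, 2084, 2310, 2357, 2589, 3000, 3010]), (14, [64, 232, 452, 2166,
   2537, 2939, 3051, 3421]), (15, [273, 581, 967, 1070, 1214, 2044, 3058, 3398, 3677]), (16, [18,
   124, 373, 856, 875, 1191, 1330, 1678, 1775, 1804, 2440, 2491, 2801, 2966, 3181, 3567, 3652,
   4049]), (17, [150, 447, 472, 648, 1765, 1922, 2155, 2863, 3425]), (18, [682, 1440, 1547, 3304,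
   3907]), (19, [489, 1225, 1493, 2826, 3108, 3626]), (20, [0, 333, 347, 714, 883, 1409, 1555,
   2990, 3312, 3560, 3750]), (21, [703, 743, 1169, 1528, 1829, 2052, 2140, 3063, 3428, 3698,
   3867]), (22, [172, 1018, 1961, 2189, 2334, 2621, 3402, 4081]), (23, [171, 397, 879, 1518,
   1702, 2143, 2312, 2559, 2632, 3209, 3860])]"

definition octad_data :: "(nat \<times> nat list) list" where
  "octad_data =
   [(7, [301]), (10, [160, 170]), (12, [13]), (15, [113]), (16, [175]), (20, [67]), (23, [39]),
   (33, [10, 43]), (37, [18, 55]), (47, [190]), (56, [20, 44]), (60, [12, 48]), (92, [109]),
   (100, [12]), (114, [70, 222]), (125, [75]), (126, [71]), (132, [4]), (142, [145]), (154,
   [204]), (188, [209]), (197, [30, 183]), (222, [169]), (230, [243]), (234, [32, 45]), (246,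
   [181]), (249, [6]), (251, [231]), (252, [98, 111]), (260, [400]), (264, [24, 272]), (269,
   [148]), (272, [268]), (308, [289]), (368, [134, 468]), (372, [206]), (394, [46]), (414, [64,
   291, 330]), (432, [102, 301]), (433, [108, 295]), (464, [2]), (469, [287]), (482, [36]), (492,
   [25]), (493, [61, 282]), (495, [264]), (501, [4, 293]), (510, [287]), (512, [544]), (559,
   [783]), (564, [51, 512]), (610, [256, 844]), (629, [324]), (720, [928]), (734, [2]), (744,
   [12, 651, 652]), (773, [135]), (784, [144]), (785, [156]), (796, [10, 668]), (848, [740]),
   (866, [514, 577]), (879, [1, 513, 674]), (896, [628]), (900, [16]), (903, [90]), (920, [35,
   576]), (933, [17, 584]), (945, [117]), (960, [40]), (970, [74, 520]), (996, [142, 517]), (999,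
   [7]), (1007, [512]), (1014, [555]), (1016, [0, 515]), (1020, [527]), (1076, [526, 1544]),
   (1128, [548]), (1184, [1100]), (1192, [140]), (1236, [3, 1159]), (1237, [1674]), (1280,
   [1828]), (1320, [1160]), (1370, [1920]), (1445, [262, 1093]), (1505, [532, 1813]), (1573,
   [81]), (1576, [1044]), (1593, [299, 1032]), (1599, [279]), (1608, [71]), (1656, [327]), (1662,
   [1379]), (1728, [267, 1033]), (1805, [132, 1047]), (1806, [16]), (1808, [1062]), (1809, [176,
   1073]), (1855, [157, 1026]), (1866, [82]), (1872, [17, 1173]), (1876, [132, 1029]), (1928,
   [1037]), (1965, [68, 1075]), (1969, [66, 1033]), (1970, [11, 1056, 1090]), (1972, [193,
   1098]), (1974, [1113]), (1986, [28, 1050]), (2008, [50, 1029]), (2016, [112]), (2028, [99,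
   1125]), (2036, [47, 1187]), (2037, [34, 1067]), (2039, [1028]), (2043, [46, 1101]), (2073,
   [35, 2080, 3175]), (2088, [1034]), (2117, [1053, 3090]), (2138, [12]), (2149, [2066]), (2152,
   [3073]), (2154, [6]), (2209, [134, 2055]), (2234, [3219]), (2368, [280]), (2384, [1408]),
   (2452, [1061, 3364]), (2470, [1027, 3328]), (2506, [2386]), (2634, [3591]), (2637, [770,
   2309]), (2640, [1, 2579]), (2944, [2562]), (2949, [1062, 3619]), (2974, [1041]), (2984,
   [1538]), (2992, [2561]), (3008, [1536, 3074]), (3072, [2634]), (3077, [527]), (3112, [2610]),
   (3176, [525, 2075]), (3177, [2613]), (3192, [2086]), (3208, [21]), (3215, [2571]), (3249,
   [649, 2048]), (3312, [643, 2120]), (3464, [258]), (3552, [2128]), (3579, [2884]), (3584, [72,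
   2368]), (3658, [298]), (3685, [2059]), (3710, [2048]), (3712, [130, 2438]), (3744, [40,
   2336]), (3850, [2256]), (3880, [9, 2272]), (3914, [2064]), (3930, [2211]), (3936, [2183]),
   (3938, [2198]), (3946, [2058]), (3948, [152, 2078]), (3951, [143]), (3963, [23]), (3973,
   [2132]), (3981, [70, 2127]), (3988, [30, 2128]), (3989, [23, 32, 2090]), (3996, [11]), (4010,
   [36]), (4032, [2098]), (4052, [6, 2058]), (4064, [88]), (4065, [2108]), (4079, [80]), (4080,
   [29, 2070])]"

text \<open>Grouped by absolute values of the entries. A sign change never leaves its group, so
  unions of sign-changed copies can be counted group by group.\<close>

definition code_groups :: "(int list \<times> bool list list) list" where
  "code_groups = map (\<lambda>(k, ns). (odd_base k, map word ns)) odd_data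
     @ map (\<lambda>(n, ns). (octad_base n, map word ns)) octad_data
     @ [(pair_base 9 21, map word [8, 1024])]"

text \<open>Sign changes on these codewords move the code to almost disjoint copies of itself; the order was
  chosen greedily.\<close>

definition shifts :: "bool list list" where
  "shifts = map word
   [0, 1022, 1305, 556, 3042, 815, 1767, 3881, 1227, 466, 3835, 3287, 3333, 2510, 2076, 2608,
   1845, 259, 4088, 1480, 1590, 3078, 2020, 2785, 2867, 2335, 1050, 2253, 765, 3540, 3626, 209,
   3185, 603, 2631, 3232, 1133, 3491, 421]"

fun signed_all :: "(int list \<times> bool list list) list \<Rightarrow> int list list" where
  "signed_all [] = []"
| "signed_all ((b, []) # gs) = signed_all gs"
| "signed_all ((b, w # ws) # gs) = signs w b # signed_all ((b, ws) # gs)"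

text \<open>
  Vectors of norm \<open>32\<close> have inner product at most \<open>8\<close> if and only if their squared distance is at
  least \<open>48\<close>; distances allow an evaluation from left to right to stop early.
\<close>

definition far :: "int list \<Rightarrow> int list \<Rightarrow> nat \<Rightarrow> bool" where
  "far xs ys n \<longleftrightarrow> 48 \<le> int n + (\<Sum>(x, y)\<leftarrow>zip xs ys. (x - y)^2)"

fun far_from :: "int list \<Rightarrow> int list list \<Rightarrow> bool" where
  "far_from x [] = True"
| "far_from x (y # ys) = (far x y 0 \<and> far_from x ys)"

fun all_far :: "int list list \<Rightarrow> bool" where
  "all_far [] = True"
| "all_far (x # xs) = (far_from x xs \<and> all_far xs)"

lemma far_Cons: "far (x # xs) (y # ys) n = far xs ys ((Suc ^^ nat ((x - y)^2)) n)"
proof -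
  have "(Suc ^^ k) n = k + n" for k by (induction k) auto
  then show ?thesis by (simp add: far_def algebra_simps)
qed

text \<open>All entries of code vectors lie in this range. Each pair of values becomes one rewrite
  rule that adds the squared difference in unary, and \<open>far_stop\<close> fires once 48
  successors have accumulated.\<close>

lemma far_table: "\<forall>x\<in>set [-4, -3, -2, -1, 0, 1, 2, 3, 4]. \<forall>y\<in>set [-4, -3, -2, -1, 0, 1, 2, 3, 4].
    far (x # xs) (y # ys) n = far xs ys ((Suc ^^ nat ((x - y)^2)) n)"
  by (intro ballI) (rule far_Cons)

lemma far_stop: "far xs ys ((Suc ^^ 48) n)"
proof -
  have "(Suc ^^ 48) n = 48 + n" by (simp add: numeral_eq_Suc)
  moreover have "0 \<le> (\<Sum>(x, y)\<leftarrow>zip xs ys. (x - y)^2)"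
    by (intro sum_list_nonneg) auto
  ultimately show ?thesis by (simp add: far_def)
qed

lemmas far_rules = far_table[simplified, unfolded to_Suc add_Suc add_0]
  far_stop[unfolded to_Suc funpow.simps o_apply id_apply]

lemma bits_12:
  "bits 12 n = bits (Suc (Suc (Suc (Suc (Suc (Suc (Suc (Suc (Suc (Suc (Suc (Suc 0)))))))))))) n"
  by (simp only: to_Suc)

lemma word_rules:
  "bits 0 n = []"
  "bits (Suc k) 0 = False # bits k 0"
  "bits (Suc k) 1 = True # bits k 0"
  "bits (Suc k) (numeral Num.One) = True # bits k 0"
  "bits (Suc k) (numeral (Num.Bit0 m)) = False # bits k (numeral m)"
  "bits (Suc k) (numeral (Num.Bit1 m)) = True # bits k (numeral m)"
  "combine (True # us) (b # bs) acc = combine us bs (xor_word b acc)"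
  "combine (False # us) (b # bs) acc = combine us bs acc"
  "combine [] [] acc = acc"
  by simp_all

lemma base_rules:
  "octad_base n = map (\<lambda>b. if b then 2 else 0) (word n)"
  "odd_base k = list_update [1, 1, 1, 1, 1, 1, 1, 1, 1, 1, 1, 1, 1, 1, 1, 1, 1, 1, 1, 1, 1, 1, 1, 1] k (-3)"
  "pair_base j k = list_update (list_update
     [0, 0, 0, 0, 0, 0, 0, 0, 0, 0, 0, 0, 0, 0, 0, 0, 0, 0, 0, 0, 0, 0, 0, 0] j 4) k 4"
  by (simp_all add: octad_base_def odd_base_def pair_base_def numeral_eq_Suc)

lemma update_rules:
  "list_update (x # xs) 0 y = y # xs"
  "list_update (x # xs) 1 y = x # list_update xs 0 y"
  "list_update (x # xs) (numeral m) y = x # list_update xs (pred_numeral m) y"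
  by (simp_all add: numeral_eq_Suc)

lemma sign_rules:
  "signs (True # w) (x # xs) = - x # signs w xs"
  "signs (False # w) (x # xs) = x # signs w xs"
  "signs [] [] = []"
  by simp_all

lemmas group_eval = code_groups_def odd_data_def octad_data_def shifts_def word_def encode_def zero_word_eval
  golay_basis_eval bits_12 word_rules word_eval base_rules update_rules pred_numeral_simps BitM.simps
  list.map append.simps prod.case if_True if_False

lemma all_far_code: "all_far (signed_all code_groups)"
  \<comment> \<open>The first pass writes out the code as explicit lists; the second compares all
    pairs by table lookup, without arithmetic.\<close>
  by (simp only: group_eval signed_all.simps sign_rules minus_minus minus_zero)
    (simp only: all_far.simps far_from.simps far_rules simp_thms)

section \<open>Counting distinct sign patterns with tries\<close>

datatype trie = Empty | Leaf "bool list" | Node trie trie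

text \<open>A lone word stays in one leaf until another word arrives. Clauses meeting words of
  different lengths may drop a word but never invent one, so \<open>leaves\<close> is always a lower
  bound for the number of distinct words inserted.\<close>

fun ins :: "bool list \<Rightarrow> trie \<Rightarrow> trie" where
  "ins bs Empty = Leaf bs"
| "ins [] (Leaf cs) = Leaf cs"
| "ins bs (Leaf []) = Leaf []"
| "ins (True # bs) (Leaf (True # cs)) = Node Empty (ins bs (Leaf cs))"
| "ins (False # bs) (Leaf (False # cs)) = Node (ins bs (Leaf cs)) Empty"
| "ins (True # bs) (Leaf (False # cs)) = Node (Leaf cs) (Leaf bs)"
| "ins (False # bs) (Leaf (True # cs)) = Node (Leaf bs) (Leaf cs)"
| "ins [] (Node l r) = Node l r"
| "ins (False # bs) (Node l r) = Node (ins bs l) r"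
| "ins (True # bs) (Node l r) = Node l (ins bs r)"

fun leaves :: "trie \<Rightarrow> nat" where
  "leaves Empty = 0"
| "leaves (Leaf bs) = 1"
| "leaves (Node l r) = leaves l + leaves r"

fun trie_set :: "trie \<Rightarrow> bool list set" where
  "trie_set Empty = {}"
| "trie_set (Leaf bs) = {bs}"
| "trie_set (Node l r) = (#) False ` trie_set l \<union> (#) True ` trie_set r"

lemma card_trie_set: "finite (trie_set t) \<and> card (trie_set t) = leaves t"
proof (induction t)
  case (Node l r)
  then have "card (trie_set (Node l r)) = card ((#) False ` trie_set l) + card ((#) True ` trie_set r)"
    unfolding trie_set.simps by (intro card_Un_disjoint) auto
  then show ?case using Node by (simp add: card_image)
qed auto

lemma trie_set_ins: "trie_set (ins bs t) \<subseteq> insert bs (trie_set t)"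
  by (induction bs t rule: ins.induct) auto

text \<open>The sign pattern of \<open>signs (xor_word w e) b\<close>, restricted to the support of \<open>b\<close>.\<close>

fun key :: "int list \<Rightarrow> bool list \<Rightarrow> bool list \<Rightarrow> bool list" where
  "key (x # b) (s # w) (t # e) = (if x = 0 then key b w e else (s \<noteq> t) # key b w e)"
| "key _ _ _ = []"

fun ins_shifts :: "int list \<Rightarrow> bool list \<Rightarrow> bool list list \<Rightarrow> trie \<Rightarrow> trie" where
  "ins_shifts b w [] t = t"
| "ins_shifts b w (e # es) t = ins_shifts b w es (ins (key b w e) t)"

fun ins_words :: "int list \<Rightarrow> bool list list \<Rightarrow> bool list list \<Rightarrow> trie \<Rightarrow> trie" where
  "ins_words b [] es t = t"
| "ins_words b (w # ws) es t = ins_words b ws es (ins_shifts b w es t)"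

fun count_shifted :: "bool list list \<Rightarrow> (int list \<times> bool list list) list \<Rightarrow> nat" where
  "count_shifted es [] = 0"
| "count_shifted es ((b, ws) # gs) = leaves (ins_words b ws es Empty) + count_shifted es gs"

lemma key_rules:
  "key (0 # b) (s # w) (t # e) = key b w e"
  "key (1 # b) (True # w) (True # e) = False # key b w e"
  "key (1 # b) (True # w) (False # e) = True # key b w e"
  "key (1 # b) (False # w) (True # e) = True # key b w e"
  "key (1 # b) (False # w) (False # e) = False # key b w e"
  "key (numeral n # b) (True # w) (True # e) = False # key b w e"
  "key (numeral n # b) (True # w) (False # e) = True # key b w e"
  "key (numeral n # b) (False # w) (True # e) = True # key b w e"
  "key (numeral n # b) (False # w) (False # e) = False # key b w e"
  "key (- numeral n # b) (True # w) (True # e) = False # key b w e"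
  "key (- numeral n # b) (True # w) (False # e) = True # key b w e"
  "key (- numeral n # b) (False # w) (True # e) = True # key b w e"
  "key (- numeral n # b) (False # w) (False # e) = False # key b w e"
  "key [] [] [] = []"
  by simp_all

lemma take_rules:
  "take 0 xs = []" "take 1 (x # xs) = x # take 0 xs"
  "take (numeral n) (x # xs) = x # take (pred_numeral n) xs"
  by (simp_all add: numeral_eq_Suc)

lemmas count_shifted_eval = take_rules count_shifted.simps ins_words.simps ins_shifts.simps key_rules ins.simps
  leaves.simps pred_numeral_simps BitM.simps
  arith_simps one_add_one numeral_plus_one one_plus_numeral add_0 add_0_right

text \<open>The numbers of copies 1, 2, 4, 8, 12, 24, 39 are those of the simplices used in
  dimensions 1 to 7. Beyond two copies the counts fall short of multiples of 498 because of
  overlaps; 24 copies must still reach 11712 for dimension 30.\<close>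

lemma count_shifted_1: "count_shifted (take 1 shifts) code_groups = 498"
  by (simp only: group_eval) (simp only: count_shifted_eval)

lemma count_shifted_2: "count_shifted (take 2 shifts) code_groups = 996"
  by (simp only: group_eval) (simp only: count_shifted_eval)

lemma count_shifted_4: "count_shifted (take 4 shifts) code_groups = 1988"
  by (simp only: group_eval) (simp only: count_shifted_eval)

lemma count_shifted_8: "count_shifted (take 8 shifts) code_groups = 3972"
  by (simp only: group_eval) (simp only: count_shifted_eval)

lemma count_shifted_12: "count_shifted (take 12 shifts) code_groups = 5956"
  by (simp only: group_eval) (simp only: count_shifted_eval)

lemma count_shifted_24: "count_shifted (take 24 shifts) code_groups = 11716"
  by (simp only: group_eval) (simp only: count_shifted_eval)

lemma count_shifted_39: "count_shifted (take 39 shifts) code_groups = 18383"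
  by (simp only: group_eval) (simp only: count_shifted_eval)

section \<open>Sign-changed base vectors are minimal vectors\<close>

lemma length_bits [simp]: "length (bits k n) = k"
  by (induction k arbitrary: n) auto

definition codeword :: "bool list \<Rightarrow> bool" where
  "codeword w \<longleftrightarrow> length w = 24 \<and> word_set w \<in> golay"

lemma codeword_word: "codeword (word n)"
  unfolding codeword_def word_def by (simp add: golay_encode)

lemma codeword_xor: "\<lbrakk>codeword w; codeword e\<rbrakk> \<Longrightarrow> codeword (xor_word w e)"
  using golay_sym_diff[of "word_set w" "word_set e"] by (simp add: codeword_def word_set_xor)

lemma length_signs [simp]: "length (signs w b) = min (length w) (length b)"
  by (induction w b rule: signs.induct) auto

lemma nth_signs:
  "\<lbrakk>i < length w; i < length b\<rbrakk> \<Longrightarrow> signs w b ! i = (if w ! i then - b ! i else b ! i)"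
  by (induction w b arbitrary: i rule: signs.induct) (auto simp: nth_Cons split: nat.splits)

text \<open>Demanded for all codewords, since the vectors of a shifted copy carry the signs
  \<open>xor_word w e\<close>, again a codeword.\<close>

definition good_base :: "int list \<Rightarrow> bool" where
  "good_base b \<longleftrightarrow> length b = 24 \<and> (\<forall>w. codeword w \<longrightarrow> vec_of (signs w b) \<in> min_vecs)"

lemma good_odd_base:
  assumes "k < 24" shows "good_base (odd_base k)"
  unfolding good_base_def
proof (intro conjI allI impI)
  fix w assume w: "codeword w"
  have "vec_of (signs w (odd_base k)) i = odd_vec (word_set w) k i" for i
    using w assms
    by (cases "i < 24")
      (simp_all add: vec_of_def odd_vec_def nth_signs codeword_def word_set_def odd_base_def nth_list_update)
  then have "vec_of (signs w (odd_base k)) = odd_vec (word_set w) k" by (rule ext)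
  then show "vec_of (signs w (odd_base k)) \<in> min_vecs"
    using odd_vec_min[OF _ assms] w by (simp add: codeword_def)
qed (simp add: odd_base_def)

text \<open>A codeword changes the signs on its intersection with the octad, which has even
  size.\<close>

lemma good_octad_base:
  assumes "weight (word n) = 8" shows "good_base (octad_base n)"
  unfolding good_base_def
proof (intro conjI allI impI)
  have len: "length (word n) = 24" using codeword_word by (simp add: codeword_def)
  then show "length (octad_base n) = 24" by (simp add: octad_base_def)
  fix w assume w: "codeword w"
  let ?C = "word_set (word n)"
  have "vec_of (signs w (octad_base n)) i = signed 2 ?C (?C \<inter> word_set w) i" for i
    using w len
    by (cases "i < 24") (simp_all add: vec_of_def signed_def nth_signs codeword_def word_set_def octad_base_def)
  then have "vec_of (signs w (octad_base n)) = signed 2 ?C (?C \<inter> word_set w)" by (rule ext)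
  moreover have "?C \<in> golay" "word_set w \<in> golay" "card ?C = 8"
    using codeword_word w assms by (simp_all add: codeword_def card_word_set)
  ultimately show "vec_of (signs w (octad_base n)) \<in> min_vecs"
    using signed_octad[of ?C "?C \<inter> word_set w"] golay_even_inter by simp
qed

lemma good_pair_base:
  assumes "j < 24" "k < 24" "j \<noteq> k" shows "good_base (pair_base j k)"
  unfolding good_base_def
proof (intro conjI allI impI)
  fix w assume w: "codeword w"
  have "vec_of (signs w (pair_base j k)) i = signed 4 {j, k} ({j, k} \<inter> word_set w) i" for i
    using w assms
    by (cases "i < 24") (auto simp: vec_of_def signed_def nth_signs codeword_def word_set_def
        pair_base_def nth_list_update)
  then have "vec_of (signs w (pair_base j k)) = signed 4 {j, k} ({j, k} \<inter> word_set w)" by (rule ext)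
  then show "vec_of (signs w (pair_base j k)) \<in> min_vecs"
    using signed_pair[of "{j, k}" "{j, k} \<inter> word_set w"] assms by simp
qed (simp add: pair_base_def)

lemma odd_data_range: "list_all (\<lambda>(k, ns). k < 24) odd_data"
  by (simp add: odd_data_def)

lemma octad_data_weight: "list_all (\<lambda>(n, ns). weight (word n) = Suc (Suc (Suc (Suc (Suc (Suc (Suc (Suc 0)))))))) octad_data"
  by (simp only: group_eval list.pred_inject refl simp_thms)

lemma code_groups_good:
  assumes "(b, ws) \<in> set code_groups" shows "good_base b" "\<forall>w\<in>set ws. codeword w"
proof -
  have "k < 24" if "(k, ns) \<in> set odd_data" for k ns
    using odd_data_range that by (auto simp: list_all_iff)
  moreover have "weight (word n) = 8" if "(n, ns) \<in> set octad_data" for n ns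
  proof -
    have "weight (word n) = Suc (Suc (Suc (Suc (Suc (Suc (Suc (Suc 0)))))))"
      using octad_data_weight that unfolding list_all_iff by blast
    then show ?thesis by simp
  qed
  ultimately show "good_base b"
    using assms good_odd_base good_octad_base good_pair_base by (fastforce simp: code_groups_def)
  show "\<forall>w\<in>set ws. codeword w"
    using assms by (auto simp: code_groups_def codeword_word)
qed

lemma shifts_codeword: "e \<in> set shifts \<Longrightarrow> codeword e"
  by (auto simp: shifts_def codeword_word)

lemma length_shifts: "length shifts = 39"
  by (simp add: shifts_def)

definition code_copy :: "bool list \<Rightarrow> (nat \<Rightarrow> int) set" where
  "code_copy e = {vec_of (signs (xor_word w e) b) | w b ws. (b, ws) \<in> set code_groups \<and> w \<in> set ws}"

lemma code_copy_min: "codeword e \<Longrightarrow> code_copy e \<subseteq> min_vecs"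
  using code_groups_good codeword_xor by (fastforce simp: code_copy_def good_base_def)

lemma set_signed_all: "v \<in> set (signed_all gs) \<longleftrightarrow> (\<exists>(b, ws)\<in>set gs. \<exists>w\<in>set ws. v = signs w b)"
  by (induction gs rule: signed_all.induct) auto

lemma far_sym: "far xs ys n = far ys xs n"
proof -
  have "(\<Sum>(x, y)\<leftarrow>zip xs ys. (x - y)^2) = (\<Sum>(x, y)\<leftarrow>zip ys xs. (x - y)^2)"
    by (induction xs ys rule: list_induct2') (auto simp: power2_commute)
  then show ?thesis by (simp add: far_def)
qed

lemma all_farD: "\<lbrakk>all_far vs; x \<in> set vs; y \<in> set vs; x \<noteq> y\<rbrakk> \<Longrightarrow> far x y 0"
proof (induction vs)
  case (Cons v vs)
  have "far_from v us \<Longrightarrow> u \<in> set us \<Longrightarrow> far v u 0" for u us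
    by (induction us) auto
  then have *: "far v u 0" if "u \<in> set vs" for u
    using Cons.prems(1) that unfolding all_far.simps by blast
  show ?case
  proof (cases "x = v \<or> y = v")
    case True
    then show ?thesis
      using Cons.prems(2-4) *[of x] *[of y] far_sym[of x v 0] by auto
  next
    case False
    then show ?thesis using Cons by auto
  qed
qed simp

lemma far_inner:
  assumes "far xs ys 0" "length xs = 24" "length ys = 24" "vec_of xs \<in> min_vecs" "vec_of ys \<in> min_vecs"
  shows "(\<Sum>i<24. vec_of xs i * vec_of ys i) \<le> 8"
proof -
  have "48 \<le> (\<Sum>(x, y)\<leftarrow>zip xs ys. (x - y)^2)"
    using assms(1) by (simp add: far_def)
  also have "\<dots> = (\<Sum>i<24. (vec_of xs i - vec_of ys i)^2)"
    using assms(2,3) by (simp add: sum_list_sum_nth vec_of_def atLeast0LessThan)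
  also have "\<dots> = (\<Sum>i<24. (vec_of xs i)^2) + (\<Sum>i<24. (vec_of ys i)^2) - 2 * (\<Sum>i<24. vec_of xs i * vec_of ys i)"
    by (simp add: power2_diff sum.distrib sum_subtractf sum_distrib_left mult.assoc)
  finally show ?thesis using assms(4,5) by (simp add: min_vecs_def)
qed

lemma vec_of_xor:
  assumes "length w = 24" "length e = 24" "length b = 24" "i < 24"
  shows "vec_of (signs (xor_word w e) b) i = (if e ! i then -1 else 1) * vec_of (signs w b) i"
  using assms by (simp add: vec_of_def nth_signs)

text \<open>The signs of \<open>e\<close> cancel in every product of coordinates, so each copy
  inherits the inner products of the original code and \<open>all_far_code\<close> suffices.\<close>

lemma code_copy_inner:
  assumes e: "codeword e" and x: "x \<in> code_copy e" and y: "y \<in> code_copy e" and ne: "x \<noteq> y"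
  shows "(\<Sum>i<24. x i * y i) \<le> 8"
proof -
  obtain w b ws where b: "(b, ws) \<in> set code_groups" "w \<in> set ws" "x = vec_of (signs (xor_word w e) b)"
    using x by (auto simp: code_copy_def)
  obtain v c vs where c: "(c, vs) \<in> set code_groups" "v \<in> set vs" "y = vec_of (signs (xor_word v e) c)"
    using y by (auto simp: code_copy_def)
  have w: "codeword w" "good_base b" using code_groups_good[OF b(1)] b(2) by auto
  have v: "codeword v" "good_base c" using code_groups_good[OF c(1)] c(2) by auto
  have len: "length w = 24" "length v = 24" "length e = 24" "length b = 24" "length c = 24"
    using w v e by (auto simp: codeword_def good_base_def)
  have flip: "(\<Sum>i<24. x i * y i) = (\<Sum>i<24. vec_of (signs w b) i * vec_of (signs v c) i)"
    unfolding b(3) c(3) by (intro sum.cong) (auto simp: vec_of_xor len)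
  have "signs w b \<noteq> signs v c"
  proof
    assume eq: "signs w b = signs v c"
    have "x i = y i" for i
      unfolding b(3) c(3) using vec_of_xor[of w e b i] vec_of_xor[of v e c i] eq len
      by (cases "i < 24") (simp_all add: vec_of_def)
    then show False using ne by auto
  qed
  moreover have "signs w b \<in> set (signed_all code_groups)" "signs v c \<in> set (signed_all code_groups)"
    unfolding set_signed_all using b(1,2) c(1,2) by fast+
  ultimately have "far (signs w b) (signs v c) 0"
    using all_farD[OF all_far_code] by blast
  then show ?thesis
    unfolding flip using w v len by (intro far_inner) (auto simp: good_base_def)
qed

text \<open>An invariant under sign changes that separates the bases: the zeros distinguish octads
  and the pair, the position of the 3 distinguishes the odd bases. As a list of booleans it can be
  fed to the trie.\<close>

definition signature :: "int list \<Rightarrow> bool list" where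
  "signature b = map (\<lambda>x. x = 0) b @ map (\<lambda>x. x^2 = 9) b"

lemma signature_vec:
  assumes "vec_of (signs w b) = vec_of (signs v c)" "length w = 24" "length v = 24" "length b = 24" "length c = 24"
  shows "signature b = signature c"
proof -
  have "\<bar>b ! i\<bar> = \<bar>c ! i\<bar>" if "i < 24" for i
    using fun_cong[OF assms(1), of i] that assms(2-) by (simp add: vec_of_def nth_signs split: if_splits)
  then have "b ! i = 0 \<longleftrightarrow> c ! i = 0" "(b ! i)^2 = (c ! i)^2" if "i < 24" for i
    using that by (metis abs_eq_0, metis power2_abs)
  then show ?thesis
    using assms(4,5) unfolding signature_def by (intro arg_cong2[of _ _ _ _ "(@)"] nth_equalityI) auto
qed

fun ins_list :: "bool list list \<Rightarrow> trie \<Rightarrow> trie" where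
  "ins_list [] t = t"
| "ins_list (x # xs) t = ins_list xs (ins x t)"

lemma trie_set_ins_list: "trie_set (ins_list xs t) \<subseteq> set xs \<union> trie_set t"
proof (induction xs arbitrary: t)
  case (Cons x xs)
  then show ?case using trie_set_ins[of x t] by (simp, blast)
qed simp

lemma distinct_if_leaves:
  assumes "leaves (ins_list xs Empty) = length xs" shows "distinct xs"
proof -
  have "length xs \<le> card (set xs)"
    using card_trie_set[of "ins_list xs Empty"] trie_set_ins_list[of xs Empty] assms
    by (metis List.finite_set card_mono sup_bot.right_neutral trie_set.simps(1))
  then show ?thesis using card_length[of xs] by (intro card_distinct) simp
qed

lemma distinct_signatures: "distinct (map (\<lambda>(b, ws). signature b) code_groups)"
  by (rule distinct_if_leaves, simp only: group_eval) (simp add: signature_def)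

lemma trie_set_ins_shifts:
  "trie_set (ins_shifts b w es t) \<subseteq> (\<lambda>e. key b w e) ` set es \<union> trie_set t"
proof (induction es arbitrary: t)
  case (Cons e es)
  then show ?case using trie_set_ins[of "key b w e" t] by (simp, blast)
qed simp

lemma trie_set_ins_words:
  "trie_set (ins_words b ws es t) \<subseteq> (\<lambda>(w, e). key b w e) ` (set ws \<times> set es) \<union> trie_set t"
proof (induction ws arbitrary: t)
  case (Cons w ws)
  then show ?case using trie_set_ins_shifts[of b w es t] by (simp, blast)
qed simp

text \<open>Signs are visible exactly where the base is nonzero, so a vector fixes its key.
  Different keys thus belong to different vectors, the direction needed to bound the number of
  vectors from below.\<close>

lemma key_determined:
  "\<lbrakk>signs (xor_word w e) b = signs (xor_word w' e') b; length w = length b; length e = length b;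
    length w' = length b; length e' = length b\<rbrakk> \<Longrightarrow> key b w e = key b w' e'"
proof (induction b arbitrary: w e w' e')
  case (Cons x b)
  obtain s u t d s' u' t' d' where *: "w = s # u" "e = t # d" "w' = s' # u'" "e' = t' # d'"
    using Cons.prems(2-5) by (auto simp: length_Suc_conv)
  have "signs (xor_word u d) b = signs (xor_word u' d') b"
    using Cons.prems(1) by (simp add: *)
  then have IH: "key b u d = key b u' d'"
    by (rule Cons.IH) (use Cons.prems in \<open>simp_all add: *\<close>)
  have "(if s \<noteq> t then - x else x) = (if s' \<noteq> t' then - x else x)"
    using Cons.prems(1) by (simp add: *)
  then have "x = 0 \<or> (s \<noteq> t) = (s' \<noteq> t')" by (auto split: if_splits)
  then show ?case using IH by (auto simp: *)
qed simp

lemma card_image_le_if_determined: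
  assumes "finite A" "\<And>a a'. \<lbrakk>a \<in> A; a' \<in> A; f a = f a'\<rbrakk> \<Longrightarrow> g a = g a'"
  shows "card (g ` A) \<le> card (f ` A)"
proof -
  have "g a = g (inv_into A f (f a))" if "a \<in> A" for a
    using assms(2)[of a "inv_into A f (f a)"] that by (simp add: inv_into_into f_inv_into_f)
  then have "g ` A = (\<lambda>y. g (inv_into A f y)) ` (f ` A)"
    by (auto simp: image_iff)
  then show ?thesis using card_image_le[of "f ` A" "\<lambda>y. g (inv_into A f y)"] assms(1) by simp
qed

lemma vec_of_inj: "\<lbrakk>vec_of xs = vec_of ys; length xs = length ys\<rbrakk> \<Longrightarrow> xs = ys"
  by (rule nth_equalityI) (auto simp: vec_of_def dest!: fun_cong split: if_splits)

definition shifted :: "bool list list \<Rightarrow> int list \<times> bool list list \<Rightarrow> (nat \<Rightarrow> int) set" where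
  "shifted es g = (\<lambda>(w, e). vec_of (signs (xor_word w e) (fst g))) ` (set (snd g) \<times> set es)"

lemma leaves_le_card_shifted:
  assumes "length b = 24" "\<forall>w\<in>set ws. length w = 24" "\<forall>e\<in>set es. length e = 24"
  shows "leaves (ins_words b ws es Empty) \<le> card (shifted es (b, ws))"
proof -
  have "leaves (ins_words b ws es Empty) \<le> card ((\<lambda>(w, e). key b w e) ` (set ws \<times> set es))"
    using card_mono[OF _ trie_set_ins_words[of b ws es Empty]] card_trie_set[of "ins_words b ws es Empty"]
    by simp
  also have "\<dots> \<le> card (shifted es (b, ws))"
    unfolding shifted_def fst_conv snd_conv
  proof (rule card_image_le_if_determined, simp, clarify)
    fix w e w' e'
    assume *: "w \<in> set ws" "e \<in> set es" "w' \<in> set ws" "e' \<in> set es"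
      "vec_of (signs (xor_word w e) b) = vec_of (signs (xor_word w' e') b)"
    have len: "length w = 24" "length e = 24" "length w' = 24" "length e' = 24"
      using * assms by auto
    have "signs (xor_word w e) b = signs (xor_word w' e') b"
      using *(5) by (rule vec_of_inj) (simp add: len)
    then show "key b w e = key b w' e'"
      by (rule key_determined) (simp_all add: len assms(1))
  qed
  finally show ?thesis .
qed

text \<open>Different signatures make the groups disjoint, so the lower bounds of the groups add
  up.\<close>

lemma count_shifted_le_card:
  assumes "\<forall>(b, ws)\<in>set gs. length b = 24 \<and> (\<forall>w\<in>set ws. length w = 24)" "\<forall>e\<in>set es. length e = 24"
    "distinct (map (\<lambda>(b, ws). signature b) gs)"
  shows "count_shifted es gs \<le> card (\<Union>g\<in>set gs. shifted es g)"
  using assms(1,3)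
proof (induction gs)
  case (Cons g gs)
  obtain b ws where g: "g = (b, ws)" by fastforce
  have fin: "finite (shifted es h)" for h by (simp add: shifted_def)
  have b: "length b = 24" "\<forall>w\<in>set ws. length w = 24" using Cons.prems(1) g by auto
  have "shifted es g \<inter> (\<Union>h\<in>set gs. shifted es h) = {}"
  proof (rule ccontr)
    assume "\<not> ?thesis"
    then obtain c vs w e v d where *: "(c, vs) \<in> set gs" "w \<in> set ws" "e \<in> set es" "v \<in> set vs" "d \<in> set es"
      "vec_of (signs (xor_word w e) b) = vec_of (signs (xor_word v d) c)"
      unfolding shifted_def g by fastforce
    have c: "length c = 24" "length v = 24" using Cons.prems(1) *(1,4) by auto
    have len: "length w = 24" "length e = 24" "length d = 24" using b * assms(2) by auto
    have "signature b = signature c"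
      using *(6) by (rule signature_vec) (simp_all add: b c len)
    then show False using Cons.prems(2) *(1) g by force
  qed
  then have "card (\<Union>h\<in>set (g # gs). shifted es h) = card (shifted es g) + card (\<Union>h\<in>set gs. shifted es h)"
    using card_Un_disjoint[of "shifted es g" "\<Union>h\<in>set gs. shifted es h"] fin by simp
  moreover have "leaves (ins_words b ws es Empty) \<le> card (shifted es g)"
    using leaves_le_card_shifted[OF b assms(2)] g by simp
  moreover have "count_shifted es gs \<le> card (\<Union>h\<in>set gs. shifted es h)"
    using Cons by simp
  ultimately show ?case using g by simp
qed simp

lemma count_copies:
  assumes "\<forall>e\<in>set es. codeword e"
  shows "count_shifted es code_groups \<le> card (\<Union>e\<in>set es. code_copy e)"
proof -
  have "(\<Union>g\<in>set code_groups. shifted es g) = (\<Union>e\<in>set es. code_copy e)"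
    unfolding shifted_def code_copy_def by fastforce
  moreover have "\<forall>(b, ws)\<in>set code_groups. length b = 24 \<and> (\<forall>w\<in>set ws. length w = 24)"
    using code_groups_good by (auto simp: good_base_def codeword_def)
  moreover have "\<forall>e\<in>set es. length e = 24" using assms by (simp add: codeword_def)
  ultimately show ?thesis
    using count_shifted_le_card[OF _ _ distinct_signatures, of es] by simp
qed

section \<open>Triangles of roots\<close>

definition scaled :: "(nat \<Rightarrow> int) \<Rightarrow> nat \<Rightarrow> real" where
  "scaled x i = real_of_int (x i) / sqrt 32"

lemma rn_inner_scaled: "rn_inner 24 (scaled x) (scaled y) = real_of_int (\<Sum>i<24. x i * y i) / 32"
  by (simp add: rn_inner_def scaled_def sum_divide_distrib)

lemma inj_scaled: "inj scaled"
  by (rule injI) (simp add: scaled_def fun_eq_iff)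

lemma kissing_config_min_vecs: "kissing_config 24 (scaled ` min_vecs)"
  unfolding kissing_config_def
proof (intro conjI ballI impI)
  show "finite (scaled ` min_vecs)" using finite_min_vecs by simp
  show "scaled ` min_vecs \<subseteq> unit_sphere 24"
  proof (rule image_subsetI)
    fix x assume x: "x \<in> min_vecs"
    then have "(\<Sum>i<24. x i * x i) = 32" by (simp add: min_vecs_def power2_eq_square)
    then have "rn_inner 24 (scaled x) (scaled x) = 1" by (simp only: rn_inner_scaled)
    then show "scaled x \<in> unit_sphere 24"
      using x by (simp add: unit_sphere_def rn_space_def scaled_def min_vecs_def)
  qed
  fix x y assume "x \<in> scaled ` min_vecs" "y \<in> scaled ` min_vecs" "x \<noteq> y"
  then obtain u v where uv: "u \<in> min_vecs" "v \<in> min_vecs" "u \<noteq> v" "x = scaled u" "y = scaled v" by auto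
  then show "rn_inner 24 x y \<le> 1/2"
    using min_vecs_inner[OF uv(1-3)] unfolding uv(4,5) rn_inner_scaled by linarith
qed

fun wip :: "int list \<Rightarrow> int list \<Rightarrow> int list \<Rightarrow> int" where
  "wip (w # ws) (x # p) (y # q) = w * (x * y) + wip ws p q"
| "wip _ _ _ = 0"

lemma wip_sym: "wip ws p q = wip ws q p"
  by (induction ws p q rule: wip.induct) (auto simp: mult.commute)

text \<open>The roots \<open>sqrt (ws ! i)\<close> are absorbed into the coordinates and
  \<open>N\<close> is the squared length of a root, so every condition on unit vectors turns into
  one on the integers \<open>wip\<close>.\<close>

definition point :: "int list \<Rightarrow> int \<Rightarrow> int list \<Rightarrow> nat \<Rightarrow> real" where
  "point ws N p i = (if i < length ws then sqrt (real_of_int (ws ! i) / N) * real_of_int (p ! i) else 0)"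

lemma rn_inner_point:
  assumes "\<forall>w\<in>set ws. 0 \<le> w" "0 < N" "length p = length ws" "length q = length ws"
  shows "rn_inner (length ws) (point ws N p) (point ws N q) = wip ws p q / N"
proof -
  have wip: "wip us x y = (\<Sum>i<length us. us ! i * (x ! i * y ! i))"
    if "length x = length us" "length y = length us" for us x y
    using that
  proof (induction us x y rule: wip.induct)
    case (1 w ws x p y q)
    then show ?case by (simp add: sum.lessThan_Suc_shift del: sum.lessThan_Suc)
  qed auto
  have "rn_inner (length ws) (point ws N p) (point ws N q)
      = (\<Sum>i<length ws. real_of_int (ws ! i) / N * (real_of_int (p ! i) * real_of_int (q ! i)))"
    unfolding rn_inner_def
  proof (rule sum.cong, rule refl)
    fix i assume "i \<in> {..<length ws}"
    then have i: "i < length ws" and "0 \<le> ws ! i" using assms(1) by auto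
    define r where "r = sqrt (real_of_int (ws ! i) / N)"
    have rr: "r * r = real_of_int (ws ! i) / N"
      using \<open>0 \<le> ws ! i\<close> assms(2) by (simp add: r_def)
    have "point ws N p i * point ws N q i = (r * r) * (real_of_int (p ! i) * real_of_int (q ! i))"
      using i by (simp add: point_def r_def[symmetric])
    then show "point ws N p i * point ws N q i = real_of_int (ws ! i) / N * (real_of_int (p ! i) * real_of_int (q ! i))"
      by (simp only: rr)
  qed
  also have "\<dots> = wip ws p q / N"
    by (simp add: wip[OF assms(3,4)] sum_divide_distrib)
  finally show ?thesis .
qed

text \<open>Covers the antipodal pair (\<open>t = 1\<close>) together with the triangles
  (\<open>t = 2\<close>). Since \<open>wip\<close> is symmetric, \<open>sorted_wrt\<close> tests
  each pair only once.\<close>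

definition simplices :: "int list \<Rightarrow> int \<Rightarrow> nat \<Rightarrow> int list list list \<Rightarrow> bool" where
  "simplices ws N t Ts \<longleftrightarrow> (\<forall>w\<in>set ws. 0 \<le> w) \<and> 0 < N
     \<and> (\<forall>T\<in>set Ts. length T = Suc t \<and> (\<forall>p\<in>set T. length p = length ws \<and> wip ws p p = N)
          \<and> sorted_wrt (\<lambda>p q. 2 * wip ws p q \<le> - N) T)
     \<and> sorted_wrt (\<lambda>T T'. \<forall>p\<in>set T. \<forall>q\<in>set T'. 2 * wip ws p q \<le> N) Ts"

lemma sorted_wrt_nth_sym:
  assumes "sorted_wrt P xs" "i < length xs" "j < length xs" "i \<noteq> j" "\<And>x y. P x y \<Longrightarrow> P y x"
  shows "P (xs ! i) (xs ! j)"
  using assms sorted_wrt_nth_less[of P xs i j] sorted_wrt_nth_less[of P xs j i]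
  by (cases "i < j") auto

lemma kissing_number_simplices:
  assumes S: "simplices ws N t Ts" and len: "length Ts \<le> 39"
  shows "196560 + t * count_shifted (take (length Ts) shifts) code_groups \<le> kissing_number (24 + length ws)"
proof -
  let ?m = "length Ts" and ?pt = "point ws N" and ?in = "rn_inner (length ws)"
  let ?es = "take ?m shifts"
  define copy where "copy j = scaled ` code_copy (shifts ! j)" for j
  define U where "U = (\<Union>j<?m. copy j)"
  \<comment> \<open>Copies overlap; any copy containing \<open>x\<close> may give its colour, and
    the first one is taken.\<close>
  define col where "col x = (LEAST j. j < ?m \<and> x \<in> copy j)" for x
  define T where "T j = ?pt ` set (Ts ! j)" for j
  have pos: "\<forall>w\<in>set ws. 0 \<le> w" "0 < N" using S by (auto simp: simplices_def)
  have TsD: "length A = Suc t" "sorted_wrt (\<lambda>p q. 2 * wip ws p q \<le> - N) A" if "A \<in> set Ts" for A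
    using S that by (auto simp: simplices_def)
  have pD: "length p = length ws" "wip ws p p = N" if "A \<in> set Ts" "p \<in> set A" for A p
    using S that by (auto simp: simplices_def)
  have ip: "?in (?pt p) (?pt q) = wip ws p q / N" if "A \<in> set Ts" "p \<in> set A" "B \<in> set Ts" "q \<in> set B" for A B p q
    using rn_inner_point[OF pos] pD that by blast
  have within: "2 * wip ws (A ! i) (A ! j) \<le> - N" if "A \<in> set Ts" "i < length A" "j < length A" "i \<noteq> j" for A i j
    using sorted_wrt_nth_sym[OF TsD(2)[OF that(1)] that(2-)] wip_sym by metis
  have cw: "codeword (shifts ! j)" if "j < ?m" for j
    using that len by (intro shifts_codeword nth_mem) (simp add: length_shifts)
  have es: "set ?es = (\<lambda>j. shifts ! j) ` {..<?m}"
    using nth_image[of ?m shifts] len by (simp add: length_shifts atLeast0LessThan)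
  have UM: "U \<subseteq> scaled ` min_vecs"
    using code_copy_min[OF cw] by (auto simp: U_def copy_def)
  have "U = scaled ` (\<Union>e\<in>set ?es. code_copy e)"
    unfolding U_def copy_def es by blast
  then have cardU: "count_shifted ?es code_groups \<le> card U"
    using count_copies[of ?es] cw es card_image[OF inj_on_subset[OF inj_scaled subset_UNIV]] by simp
  have colD: "col x < ?m \<and> x \<in> copy (col x)" if "x \<in> U" for x
    unfolding col_def by (rule LeastI_ex) (use that in \<open>auto simp: U_def\<close>)
  have "card (scaled ` min_vecs) + t * card U \<le> kissing_number (24 + length ws)"
  proof (rule kissing_number_lift[where col = col and m = ?m and T = T])
    show "kissing_config 24 (scaled ` min_vecs)" by (rule kissing_config_min_vecs)
    show "U \<subseteq> scaled ` min_vecs" by (rule UM)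
    show "col x < ?m" if "x \<in> U" for x using colD[OF that] by simp
  next
    fix x y assume xy: "x \<in> U" "y \<in> U" "x \<noteq> y" "col x = col y"
    then obtain u v where uv: "u \<in> code_copy (shifts ! col x)" "v \<in> code_copy (shifts ! col x)"
      "x = scaled u" "y = scaled v"
      using colD[OF xy(1)] colD[OF xy(2)] unfolding copy_def by (metis imageE)
    then have "(\<Sum>i<24. u i * v i) \<le> 8"
      using colD[OF xy(1)] xy(3) by (intro code_copy_inner[OF cw]) auto
    then show "rn_inner 24 x y \<le> 1/4"
      unfolding uv rn_inner_scaled by linarith
  next
    fix j assume j: "j < ?m"
    then have A: "Ts ! j \<in> set Ts" by simp
    have inj: "p = q" if pq: "p \<in> set (Ts ! j)" "q \<in> set (Ts ! j)" "?pt p = ?pt q" for p q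
    proof (rule ccontr)
      assume "p \<noteq> q"
      obtain i k where ik: "i < length (Ts ! j)" "k < length (Ts ! j)" "p = Ts ! j ! i" "q = Ts ! j ! k"
        using pq(1,2) by (metis in_set_conv_nth)
      then have "2 * wip ws p q \<le> - N" using within[OF A, of i k] \<open>p \<noteq> q\<close> by auto
      moreover have "wip ws p q / N = wip ws p p / N"
        using ip[OF A pq(1) A pq(2)] ip[OF A pq(1) A pq(1)] pq(3) by simp
      ultimately show False using pD(2)[OF A pq(1)] pos(2) by simp
    qed
    have "distinct (Ts ! j)"
      unfolding distinct_conv_nth
    proof (intro allI impI notI)
      fix i k assume ik: "i < length (Ts ! j)" "k < length (Ts ! j)" "i \<noteq> k" "Ts ! j ! i = Ts ! j ! k"
      then have "2 * wip ws (Ts ! j ! i) (Ts ! j ! i) \<le> - N" using within[OF A ik(1-3)] by simp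
      then show False using pD(2)[OF A nth_mem[OF ik(1)]] pos(2) by simp
    qed
    then have "card (T j) = Suc t"
      unfolding T_def using inj TsD(1)[OF A] by (subst card_image) (auto simp: inj_on_def distinct_card)
    moreover have "T j \<subseteq> unit_sphere (length ws)"
      using ip[OF A _ A] pD(2)[OF A] pos(2) by (auto simp: T_def unit_sphere_def rn_space_def point_def[abs_def])
    ultimately show "finite (T j) \<and> card (T j) = Suc t \<and> T j \<subseteq> unit_sphere (length ws)"
      by (simp add: T_def)
    fix x y assume xy: "x \<in> T j" "y \<in> T j" "x \<noteq> y"
    then obtain p q where pq: "p \<in> set (Ts ! j)" "q \<in> set (Ts ! j)" "x = ?pt p" "y = ?pt q"
      unfolding T_def by blast
    obtain i where i: "i < length (Ts ! j)" "p = Ts ! j ! i"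
      using pq(1) unfolding in_set_conv_nth by blast
    obtain k where k: "k < length (Ts ! j)" "q = Ts ! j ! k"
      using pq(2) unfolding in_set_conv_nth by blast
    have ik: "i < length (Ts ! j)" "k < length (Ts ! j)" "x = ?pt (Ts ! j ! i)" "y = ?pt (Ts ! j ! k)"
      using i k pq(3,4) by simp_all
    then have "2 * wip ws (Ts ! j ! i) (Ts ! j ! k) \<le> - N"
      using within[OF A, of i k] xy(3) by auto
    then have "real_of_int (2 * wip ws (Ts ! j ! i) (Ts ! j ! k)) \<le> real_of_int (- N)"
      by (simp only: of_int_le_iff)
    then show "?in x y \<le> - 1/2"
      unfolding ik(3,4) ip[OF A nth_mem[OF ik(1)] A nth_mem[OF ik(2)]] using pos(2) by (simp add: field_simps)
  next
    fix i j x y assume ij: "i < ?m" "j < ?m" "i \<noteq> j" and xy: "x \<in> T i" "y \<in> T j"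
    then obtain p q where pq: "p \<in> set (Ts ! i)" "q \<in> set (Ts ! j)" "x = ?pt p" "y = ?pt q"
      by (auto simp: T_def)
    have "sorted_wrt (\<lambda>A B. \<forall>p\<in>set A. \<forall>q\<in>set B. 2 * wip ws p q \<le> N) Ts"
      using S by (simp add: simplices_def)
    then have "\<forall>p\<in>set (Ts ! i). \<forall>q\<in>set (Ts ! j). 2 * wip ws p q \<le> N"
      by (rule sorted_wrt_nth_sym[OF _ ij]) (intro ballI, subst wip_sym, blast)
    then have le: "real_of_int (2 * wip ws p q) \<le> real_of_int N"
      using pq by (simp only: of_int_le_iff)
    have eq: "?in x y = wip ws p q / N"
      unfolding pq(3,4) using ij pq(1,2) by (intro ip[where A = "Ts ! i" and B = "Ts ! j"]) auto
    show "?in x y \<le> 1/2"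
      unfolding eq using le pos(2) by (simp add: field_simps)
  qed
  moreover have "card (scaled ` min_vecs) = card min_vecs"
    by (rule card_image[OF inj_on_subset[OF inj_scaled subset_UNIV]])
  ultimately show ?thesis
    using card_min_vecs mult_le_mono2[OF cardU, of t] by linarith
qed

definition triangle :: "int list \<times> int list \<Rightarrow> int list list" where
  "triangle = (\<lambda>(p, q). [p, q, map2 (\<lambda>x y. - x - y) p q])"

text \<open>
  Disjoint triangles of roots with sum zero; the third root is left out. The weights \<open>3\<close> replace
  coordinates with a factor \<open>sqrt 3\<close>.
\<close>

definition triangles_A2 :: "int list list list" where
  "triangles_A2 = map triangle
     [([2, 0], [-1, 1]),
      ([-2, 0], [1, -1])]"

lemma simplices_A2: "simplices [1, 3] 4 2 triangles_A2"
  by (simp add: simplices_def triangles_A2_def triangle_def)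

lemma length_triangles_A2: "length triangles_A2 = 2"
  by (simp add: triangles_A2_def)

definition triangles_A3 :: "int list list list" where
  "triangles_A3 = map triangle
     [([1, 1, 0], [-1, 0, 1]),
      ([1, -1, 0], [-1, 0, -1]),
      ([-1, 1, 0], [1, 0, -1]),
      ([-1, -1, 0], [1, 0, 1])]"

lemma simplices_A3: "simplices [1, 1, 1] 2 2 triangles_A3"
  by (simp add: simplices_def triangles_A3_def triangle_def)

lemma length_triangles_A3: "length triangles_A3 = 4"
  by (simp add: triangles_A3_def)

definition triangles_D4 :: "int list list list" where
  "triangles_D4 = map triangle
     [([1, 1, 0, 0], [-1, 0, 1, 0]),
      ([1, -1, 0, 0], [-1, 0, -1, 0]),
      ([-1, 1, 0, 0], [1, 0, 0, 1]),
      ([-1, -1, 0, 0], [1, 0, 0, -1]),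
      ([0, 1, -1, 0], [0, -1, 0, 1]),
      ([1, 0, -1, 0], [-1, 0, 0, -1]),
      ([1, 0, 1, 0], [-1, 0, 0, 1]),
      ([0, -1, 1, 0], [0, 1, 0, -1])]"

lemma simplices_D4: "simplices [1, 1, 1, 1] 2 2 triangles_D4"
  by (simp add: simplices_def triangles_D4_def triangle_def)

lemma length_triangles_D4: "length triangles_D4 = 8"
  by (simp add: triangles_D4_def)

text \<open>These use 36 of the 40 roots; 13 triangles would be the most that counting
  allows.\<close>

definition triangles_D5 :: "int list list list" where
  "triangles_D5 = map triangle
     [([1, 1, 0, 0, 0], [-1, 0, 1, 0, 0]),
      ([1, -1, 0, 0, 0], [-1, 0, -1, 0, 0]),
      ([-1, 1, 0, 0, 0], [1, 0, 0, 1, 0]),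
      ([-1, -1, 0, 0, 0], [1, 0, 0, -1, 0]),
      ([-1, 0, 0, 1, 0], [1, 0, 0, 0, 1]),
      ([-1, 0, 0, -1, 0], [1, 0, 0, 0, -1]),
      ([0, -1, 1, 0, 0], [0, 1, 0, 0, 1]),
      ([1, 0, 1, 0, 0], [-1, 0, 0, 0, -1]),
      ([1, 0, -1, 0, 0], [-1, 0, 0, 0, 1]),
      ([0, 1, 0, -1, 0], [0, -1, 0, 0, 1]),
      ([0, -1, 0, 1, 0], [0, 1, 0, 0, -1]),
      ([0, 1, -1, 0, 0], [0, -1, 0, 0, -1])]"

lemma simplices_D5: "simplices [1, 1, 1, 1, 1] 2 2 triangles_D5"
  by (simp add: simplices_def triangles_D5_def triangle_def)

lemma length_triangles_D5: "length triangles_D5 = 12"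
  by (simp add: triangles_D5_def)

text \<open>Coordinates adapted to three orthogonal copies of \<open>A2\<close>: 18 roots inside the
  planes and 54 with a component of squared length 4 in each plane. The triangles use all
  72.\<close>

definition triangles_E6 :: "int list list list" where
  "triangles_E6 = map triangle
     [([3, 1, 0, 0, 0, 0], [-3, 1, 0, 0, 0, 0]),
      ([3, -1, 0, 0, 0, 0], [0, 2, 0, 0, 0, 0]),
      ([2, 0, 2, 0, 2, 0], [-1, 1, -1, 1, -1, 1]),
      ([2, 0, 2, 0, -1, 1], [-1, 1, -1, 1, -1, -1]),
      ([2, 0, 2, 0, -1, -1], [-1, 1, -1, 1, 2, 0]),
      ([2, 0, -1, 1, 2, 0], [-1, 1, -1, -1, -1, 1]),
      ([2, 0, -1, 1, -1, 1], [-1, 1, -1, -1, -1, -1]),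
      ([2, 0, -1, 1, -1, -1], [-1, 1, -1, -1, 2, 0]),
      ([2, 0, -1, -1, 2, 0], [-1, 1, 2, 0, -1, 1]),
      ([2, 0, -1, -1, -1, 1], [-1, 1, 2, 0, -1, -1]),
      ([2, 0, -1, -1, -1, -1], [-1, 1, 2, 0, 2, 0]),
      ([1, 1, 1, 1, 1, 1], [-2, 0, -2, 0, -2, 0]),
      ([1, 1, 1, 1, 1, -1], [-2, 0, -2, 0, 1, 1]),
      ([1, 1, 1, 1, -2, 0], [-2, 0, -2, 0, 1, -1]),
      ([1, 1, 1, -1, 1, 1], [-2, 0, 1, 1, -2, 0]),
      ([1, 1, 1, -1, 1, -1], [-2, 0, 1, 1, 1, 1]),
      ([1, 1, 1, -1, -2, 0], [-2, 0, 1, 1, 1, -1]),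
      ([1, 1, -2, 0, 1, 1], [-2, 0, 1, -1, -2, 0]),
      ([1, 1, -2, 0, 1, -1], [-2, 0, 1, -1, 1, 1]),
      ([1, 1, -2, 0, -2, 0], [-2, 0, 1, -1, 1, -1]),
      ([0, 0, 3, 1, 0, 0], [0, 0, -3, 1, 0, 0]),
      ([0, 0, 3, -1, 0, 0], [0, 0, 0, 2, 0, 0]),
      ([0, 0, 0, 0, 3, 1], [0, 0, 0, 0, -3, 1]),
      ([0, 0, 0, 0, 3, -1], [0, 0, 0, 0, 0, 2])]"

lemma simplices_E6: "simplices [1, 3, 1, 3, 1, 3] 12 2 triangles_E6"
  by (simp add: simplices_def triangles_E6_def triangle_def)

lemma length_triangles_E6: "length triangles_E6 = 24"
  by (simp add: triangles_E6_def)

text \<open>The 126 roots are the 14 vectors with one entry 2 or -2 and the 7 * 16 sign patterns on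
  the weight-four words of the simplex code of length 7. The 39 triangles use 117 of them.\<close>

definition triangles_E7 :: "int list list list" where
  "triangles_E7 = map triangle
     [([2, 0, 0, 0, 0, 0, 0], [-1, 0, 0, 1, 0, 1, 1]),
      ([0, 0, 0, 2, 0, 0, 0], [1, 0, 0, -1, 0, 1, -1]),
      ([0, 0, 0, 0, 0, 2, 0], [0, 0, 1, 0, 1, -1, 1]),
      ([0, 0, 0, 0, 0, 0, 2], [0, 0, 1, 0, 1, -1, -1]),
      ([-2, 0, 0, 0, 0, 0, 0], [1, 0, 0, 1, 0, 1, -1]),
      ([0, 0, 0, 0, 0, 0, -2], [1, 0, 0, 1, 0, -1, 1]),
      ([0, -2, 0, 0, 0, 0, 0], [1, 1, 0, 0, -1, 0, -1]),
      ([0, 0, 0, 0, 2, 0, 0], [0, 0, 1, 0, -1, 1, -1]),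
      ([0, 0, 1, 0, 1, 1, -1], [-1, 0, 0, 1, 0, -1, 1]),
      ([0, 0, 0, 0, -2, 0, 0], [1, 1, 0, 0, 1, 0, -1]),
      ([0, 0, 1, 0, 1, 1, 1], [1, -1, 0, 0, -1, 0, -1]),
      ([0, 2, 0, 0, 0, 0, 0], [1, -1, 0, 0, 1, 0, -1]),
      ([0, 0, 2, 0, 0, 0, 0], [0, 1, -1, -1, 0, 0, -1]),
      ([0, 0, -2, 0, 0, 0, 0], [1, 1, 1, 0, 0, 1, 0]),
      ([0, 0, 0, -2, 0, 0, 0], [0, 1, -1, 1, 0, 0, -1]),
      ([0, 0, -1, 0, 1, 1, -1], [0, 1, 1, 1, 0, 0, 1]),
      ([0, 0, 1, 0, -1, 1, 1], [1, 0, 0, -1, 0, -1, -1]),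
      ([0, 0, 1, 0, -1, -1, -1], [0, 1, -1, 1, 0, 0, 1]),
      ([0, 0, 0, 0, 0, -2, 0], [0, 1, 0, -1, -1, 1, 0]),
      ([-1, 0, 0, 1, 0, 1, -1], [1, 1, -1, 0, 0, -1, 0]),
      ([1, 1, 0, 0, -1, 0, 1], [0, -1, -1, -1, 0, 0, -1]),
      ([-1, 0, 0, -1, 0, 1, -1], [1, -1, 0, 0, 1, 0, 1]),
      ([0, 0, 1, 0, -1, -1, 1], [-1, 1, 0, 0, 1, 0, -1]),
      ([1, 0, 0, 1, 0, -1, -1], [-1, 1, 1, 0, 0, 1, 0]),
      ([-1, 0, 0, 1, 0, -1, -1], [1, -1, 0, 0, -1, 0, 1]),
      ([1, -1, -1, 0, 0, -1, 0], [-1, 0, 1, -1, 1, 0, 0]),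
      ([1, 1, 1, 0, 0, -1, 0], [-1, 0, -1, -1, 1, 0, 0]),
      ([-1, 1, 0, 0, -1, 0, 1], [0, -1, 1, 1, 0, 0, -1]),
      ([-1, 1, -1, 0, 0, 1, 0], [1, 0, 1, -1, 1, 0, 0]),
      ([0, 0, -1, 0, 1, 1, 1], [-1, 1, 0, 0, -1, 0, -1]),
      ([0, 0, -1, 0, 1, -1, 1], [0, 1, 1, 1, 0, 0, -1]),
      ([1, 0, 0, -1, 0, 1, 1], [-1, 1, 1, 0, 0, -1, 0]),
      ([0, 0, -1, 0, 1, -1, -1], [1, 0, 0, 1, 0, 1, 1]),
      ([1, 1, 0, 0, 1, 0, 1], [0, -1, 1, -1, 0, 0, -1]),
      ([0, 0, -1, 0, -1, 1, 1], [0, 1, 1, -1, 0, 0, -1]),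
      ([1, 1, -1, 0, 0, 1, 0], [-1, 0, 1, 1, -1, 0, 0]),
      ([1, -1, 1, 0, 0, 1, 0], [-1, 0, -1, -1, -1, 0, 0]),
      ([-1, -1, -1, 0, 0, -1, 0], [1, 0, 1, -1, -1, 0, 0]),
      ([-1, -1, 0, 0, 1, 0, -1], [0, 1, 1, -1, 0, 0, 1])]"

lemma simplices_E7: "simplices [1, 1, 1, 1, 1, 1, 1] 4 2 triangles_E7"
  by (simp add: simplices_def triangles_E7_def triangle_def)

lemma length_triangles_E7: "length triangles_E7 = 39"
  by (simp add: triangles_E7_def)

theorem theorem3p1:
  shows "kissing_number 25 \<ge> 197048 \<and>
         kissing_number 26 \<ge> 198512 \<and>
         kissing_number 27 \<ge> 199976 \<and>
         kissing_number 28 \<ge> 204368 \<and>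
         kissing_number 29 \<ge> 208272 \<and>
         kissing_number 30 \<ge> 219984 \<and>
         kissing_number 31 \<ge> 232874"
proof -
  have "simplices [1] 1 1 [[[1], [-1]]]" by (simp add: simplices_def)
  note bounds = this simplices_A2 simplices_A3 simplices_D4 simplices_D5 simplices_E6 simplices_E7
  note lengths = length_triangles_A2 length_triangles_A3 length_triangles_D4 length_triangles_D5
    length_triangles_E6 length_triangles_E7
  note counts = count_shifted_1 count_shifted_2 count_shifted_4 count_shifted_8 count_shifted_12
    count_shifted_24 count_shifted_39
  show ?thesis
    \<comment> \<open>The values reached are 197058, 198552, 200536, 204504, 208472, 219992 and
      233326; dimension 30 has the least room, 8.\<close>
    using bounds[THEN kissing_number_simplices] by (simp add: lengths counts counts(1)[simplified])
qed

end
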